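(* Let $(M,F)$ and $(N,\widetilde F)$ be Finsler manifolds of dimensions $p$ and $n$, and let $B\Gamma^{\mathbf b}_{\text{jet}}$ be the jet Berwald linear d-connection on $J^1(TM,N)$ (defined in the context). Then all local adapted d-torsions of $B\Gamma^{\mathbf b}_{\text{jet}}$ vanish identically, except for the following fifteen families: (T1) $T^{a}_{\beta\gamma}=N^{a}_{\beta:\gamma}-N^{a}_{\gamma:\beta}={}^{\mathbf b}\mathcal R^{a}_{\beta\gamma}$; (T2) $P^{(m)\ (b)}_{(\mu)i(j)}={}^{\mathbf b}\widetilde{\mathcal P}^{m}_{ikj}\,x^k_\mu s^b$; (T3) $P^{(m)\ (b)}_{(c)i(j)}={}^{\mathbf b}\widetilde{\mathcal P}^{m}_{ikj}\,y^k_c s^b$; (T4) $R^{(m)}_{(\mu)\alpha\beta}=-\left[{}^{\mathbf b}\mathcal R^{\varepsilon}_{\mu\alpha\beta}+{}^{\mathbf b}\mathcal P^{\varepsilon}_{\mu\alpha c}N^c_\beta-{}^{\mathbf b}\mathcal P^{\varepsilon}_{\mu\beta c}N^c_\alpha\right]x^m_\varepsilon+\mathcal A_{\{\alpha,\beta\}}\left[\frac{\partial N^c_{\beta:\mu}}{\partial t^\alpha}+N^d_{\beta:\mu}B^c_{d\alpha}-N^c_{\beta:\gamma}B^\gamma_{\alpha\mu}\right]y^m_c$; (T5) $R^{(m)}_{(\mu)\alpha b}=-{}^{\mathbf b}\mathcal P^{\varepsilon}_{\mu\alpha b}x^m_\varepsilon+\left[\frac{\partial B^c_{b\mu}}{\partial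 t^\alpha}-\frac{\partial N^c_{\alpha:\mu}}{\partial s^b}+B^d_{b\mu}B^c_{d\alpha}-B^\gamma_{\alpha\mu}B^c_{\gamma b}\right]y^m_c$; (T6) $R^{(m)}_{(\mu)a\beta}={}^{\mathbf b}\mathcal P^{\varepsilon}_{\mu a\beta}x^m_\varepsilon-\left[\frac{\partial B^c_{a\mu}}{\partial t^\beta}-\frac{\partial N^c_{\beta:\mu}}{\partial s^a}+B^d_{a\mu}B^c_{d\beta}-B^\gamma_{\beta\mu}B^c_{\gamma a}\right]y^m_c$; (T7) $R^{(m)}_{(c)\alpha\beta}=-\left[{}^{\mathbf b}\mathcal R^{d}_{c\alpha\beta}+{}^{\mathbf b}\mathcal P^{d}_{c\alpha f}N^f_\beta-{}^{\mathbf b}\mathcal P^{d}_{c\beta f}N^f_\alpha\right]y^m_d$; (T8) $R^{(m)}_{(c)\alpha b}=-{}^{\mathbf b}\mathcal P^{d}_{c\alpha b}\,y^m_d$; (T9) $R^{(m)}_{(c)a\beta}={}^{\mathbf b}\mathcal P^{d}_{ca\beta}\,y^m_d$; (T10) $R^{(m)}_{(\mu)\alpha j}=-{}^{\mathbf b}\widetilde{\mathcal P}^{m}_{jkl}\,B^c_{\alpha b}s^b x^k_\mu y^l_c$; (T11) $R^{(m)}_{(\mu)aj}=-{}^{\mathbf b}\widetilde{\mathcal P}^{m}_{jkl}\,x^k_\mu y^l_a$; (T12) $R^{(m)}_{(c)\alpha j}=-{}^{\mathbf b}\widetilde{\mathcal P}^{m}_{jkl}\,B^d_{\alpha b}s^b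 y^k_c y^l_d$; (T13) $R^{(m)}_{(c)aj}=-{}^{\mathbf b}\widetilde{\mathcal P}^{m}_{jkl}\,y^k_c y^l_a$; (T14) $R^{(m)}_{(\mu)ij}=\left[{}^{\mathbf b}\widetilde{\mathcal R}^{m}_{kij}+{}^{\mathbf b}\widetilde{\mathcal P}^{m}_{kil}\widetilde N^l_j-{}^{\mathbf b}\widetilde{\mathcal P}^{m}_{kjl}\widetilde N^l_i\right]x^k_\mu-\left[{}^{\mathbf b}\widetilde{\mathcal P}^{m}_{kil}\widetilde B^l_{jp}-{}^{\mathbf b}\widetilde{\mathcal P}^{m}_{kjl}\widetilde B^l_{ip}\right]x^k_\mu y^p_a s^a$; (T15) $R^{(m)}_{(c)ij}=\left[{}^{\mathbf b}\widetilde{\mathcal R}^{m}_{kij}+{}^{\mathbf b}\widetilde{\mathcal P}^{m}_{kil}\widetilde N^l_j-{}^{\mathbf b}\widetilde{\mathcal P}^{m}_{kjl}\widetilde N^l_i\right]y^k_c-\left[{}^{\mathbf b}\widetilde{\mathcal P}^{m}_{kil}\widetilde B^l_{jp}-{}^{\mathbf b}\widetilde{\mathcal P}^{m}_{kjl}\widetilde B^l_{ip}\right]y^k_c y^p_a s^a$. Here $\mathcal A_{\{\alpha,\beta\}}$ denotes the alternate sum $\mathcal A_{\{\alpha,\beta\}}[Z_{\alpha\beta}]=Z_{\alpha\beta}-Z_{\beta\alpha}$.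
   Context: Einstein summation is used. Greek indices $\alpha,\beta,\dots$ and Latin indices $a,b,c,d,f$ run over $1,\dots,p$; Latin indices $i,j,k,l,m,r$ (and $p$ when used as an index) run over $1,\dots,n$. Finsler data. A Finsler manifold $(M,F)$: $M$ smooth, $F:TM\to[0,\infty)$ smooth on $TM\setminus\{0\}$, positively 1-homogeneous on fibres, with $g_{\alpha\beta}=\frac12\frac{\partial^2F^2}{\partial s^\alpha\partial s^\beta}$ positive definite; $(t^\alpha,s^\alpha)$ are induced coordinates on $TM$. Put $\gamma^\mu_{\alpha\beta}=\frac{g^{\mu\varepsilon}}2\left(\frac{\partial g_{\varepsilon\alpha}}{\partial t^\beta}+\frac{\partial g_{\varepsilon\beta}}{\partial t^\alpha}-\frac{\partial g_{\alpha\beta}}{\partial t^\varepsilon}\right)$, $G^\mu=\frac12\gamma^\mu_{\alpha\beta}s^\alpha s^\beta$, $N^\gamma_\alpha=\frac{\partial G^\gamma}{\partial s^\alpha}$, $B^\gamma_{\alpha\beta}=\frac{\partial^2G^\gamma}{\partial s^\alpha\partial s^\beta}$ (Berwald connection components), $\frac{\delta}{\delta t^\alpha}=\frac{\partial}{\partial t^\alpha}-N^\varepsilon_\alpha\frac{\partial}{\partial s^\varepsilon}$, and ${}^{\mathbf b}\mathcal R^\alpha_{\beta\gamma}=\frac{\delta N^\alpha_\beta}{\delta t^\gamma}-\frac{\delta N^\alpha_\gamma}{\delta t^\beta}$, ${}^{\mathbf b}\mathcal R^\alpha_{\beta\gamma\varepsilon}=\frac{\delta B^\alpha_{\beta\gamma}}{\delta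 t^\varepsilon}-\frac{\delta B^\alpha_{\beta\varepsilon}}{\delta t^\gamma}+B^\mu_{\beta\gamma}B^\alpha_{\mu\varepsilon}-B^\mu_{\beta\varepsilon}B^\alpha_{\mu\gamma}$, ${}^{\mathbf b}\mathcal P^\alpha_{\beta\gamma\varepsilon}=\frac{\partial B^\alpha_{\beta\gamma}}{\partial s^\varepsilon}$. On $TM$ the fibre coordinates are also written $s^a$; an object with mixed indices, such as $B^c_{a\beta}$, $N^c_\alpha$, ${}^{\mathbf b}\mathcal P^d_{c\alpha b}$, is the same array of functions evaluated at the corresponding numerical index values. The same objects for $(N,\widetilde F)$, with coordinates $(x^i,y^i)$ on $TN$, carry tildes: $\widetilde N^i_j,\widetilde B^i_{jk},{}^{\mathbf b}\widetilde{\mathcal R}^i_{jkl},{}^{\mathbf b}\widetilde{\mathcal P}^i_{jkl}$. Jet space. Coordinates on $TM$ are $(T^A)=(t^\alpha,s^a)$, where the capital index $A=(\alpha,a)$ runs first through the $\alpha$'s and then through the $a$'s. The 1-jet space $J^1(TM,N)$ has coordinates $(T^A,x^i,X^i_A)=(t^\alpha,s^a,x^i,x^i_\alpha,y^i_a)$, where $X^i_A$ represents $\partial x^i/\partial T^A$ ($x^i_\alpha$ for $t^\alpha$, $y^i_a$ for $s^a$). All tilded functions are regarded as functions on $J^1(TM,N)$ by evaluation at $(x^l,\,y^l_as^a)$; one works where $s\ne0$ and $(y^l_as^a)_l\neq 0$. Connections. Let ${}^{\mathbf b}\nabla$ be the linear connection on $TM\setminus\{0\}$ with ${}^{\mathbf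 b}\nabla_{\delta/\delta t^\beta}\frac{\delta}{\delta t^\alpha}=B^\gamma_{\alpha\beta}\frac{\delta}{\delta t^\gamma}$, ${}^{\mathbf b}\nabla_{\delta/\delta t^\beta}\frac{\partial}{\partial s^a}=B^c_{a\beta}\frac{\partial}{\partial s^c}$, ${}^{\mathbf b}\nabla_{\partial/\partial s^b}\frac{\delta}{\delta t^\alpha}=0$, ${}^{\mathbf b}\nabla_{\partial/\partial s^b}\frac{\partial}{\partial s^a}=0$, and let ${}^{\mathbf b}\Gamma^C_{AB}$ be its components in the coordinate basis: ${}^{\mathbf b}\nabla_{\partial/\partial T^B}\frac{\partial}{\partial T^A}={}^{\mathbf b}\Gamma^C_{AB}\frac{\partial}{\partial T^C}$. Also put $N^c_{\alpha:\beta}=\frac{\partial N^c_\alpha}{\partial t^\beta}+N^d_\alpha B^c_{d\beta}-N^c_\gamma B^\gamma_{\alpha\beta}$. (Explicitly, the nonzero ones are ${}^{\mathbf b}\Gamma^\gamma_{\alpha\beta}=B^\gamma_{\alpha\beta}$, ${}^{\mathbf b}\Gamma^c_{\alpha\beta}=N^c_{\alpha:\beta}$, ${}^{\mathbf b}\Gamma^c_{a\beta}=B^c_{a\beta}$, ${}^{\mathbf b}\Gamma^c_{\alpha b}=B^c_{\alpha b}$.) The jet Berwald nonlinear connection is ${}^{\mathbf b}M^{(j)}_{(B)A}=-{}^{\mathbf b}\Gamma^C_{AB}X^j_C$, ${}^{\mathbf b}N^{(j)}_{(B)i}=\widetilde B^j_{ik}X^k_B$, with adapted basis $\frac{\delta^{\mathbf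 J}}{\delta T^A}=\frac{\partial}{\partial T^A}-{}^{\mathbf b}M^{(j)}_{(B)A}\frac{\partial}{\partial X^j_B}$, $\frac{\delta^{\mathbf J}}{\delta x^i}=\frac{\partial}{\partial x^i}-{}^{\mathbf b}N^{(j)}_{(B)i}\frac{\partial}{\partial X^j_B}$, $\frac{\partial}{\partial X^i_A}$. The jet Berwald linear d-connection $B\Gamma^{\mathbf b}_{\text{jet}}$ is the linear connection $D$ on $J^1(TM,N)$ with $D_{\delta^{\mathbf J}/\delta T^C}\frac{\delta^{\mathbf J}}{\delta T^B}=\overline G^A_{BC}\frac{\delta^{\mathbf J}}{\delta T^A}$, $D_{\delta^{\mathbf J}/\delta T^C}\frac{\delta^{\mathbf J}}{\delta x^i}=0$, $D_{\delta^{\mathbf J}/\delta T^C}\frac{\partial}{\partial X^j_B}=G^{(i)(B)}_{(A)(j)C}\frac{\partial}{\partial X^i_A}$, $D_{\delta^{\mathbf J}/\delta x^j}\frac{\delta^{\mathbf J}}{\delta T^B}=0$, $D_{\delta^{\mathbf J}/\delta x^j}\frac{\delta^{\mathbf J}}{\delta x^i}=L^k_{ij}\frac{\delta^{\mathbf J}}{\delta x^k}$, $D_{\delta^{\mathbf J}/\delta x^k}\frac{\partial}{\partial X^j_B}=L^{(i)(B)}_{(A)(j)k}\frac{\partial}{\partial X^i_A}$, and $D_{\partial/\partial X^k_C}$ annihilates all adapted basis fields, where $\overline G^A_{BC}={}^{\mathbf b}\Gamma^A_{BC}$, $G^{(i)(B)}_{(A)(j)C}=-\delta^i_j\,{}^{\mathbf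 b}\Gamma^B_{CA}$, $L^k_{ij}=\widetilde B^k_{ij}$, $L^{(i)(B)}_{(A)(j)k}=\delta^B_A\widetilde B^i_{jk}$ ($\delta^B_A$ the Kronecker symbol on capital indices). d-torsions. The adapted d-torsions are the components of the torsion tensor of $D$ in the adapted basis. They are named as follows: $T^M_{AB}=\overline G^M_{AB}-\overline G^M_{BA}$; $P^{(m)\ (B)}_{(M)A(j)}=\frac{\partial({}^{\mathbf b}M^{(m)}_{(M)A})}{\partial X^j_B}-G^{(m)(B)}_{(M)(j)A}$; $P^{(m)\ (B)}_{(M)i(j)}=\frac{\partial({}^{\mathbf b}N^{(m)}_{(M)i})}{\partial X^j_B}-L^{(m)(B)}_{(M)(j)i}$; $R^{(m)}_{(M)AB}=\frac{\delta^{\mathbf J}({}^{\mathbf b}M^{(m)}_{(M)A})}{\delta T^B}-\frac{\delta^{\mathbf J}({}^{\mathbf b}M^{(m)}_{(M)B})}{\delta T^A}$; $R^{(m)}_{(M)Aj}=\frac{\delta^{\mathbf J}({}^{\mathbf b}M^{(m)}_{(M)A})}{\delta x^j}-\frac{\delta^{\mathbf J}({}^{\mathbf b}N^{(m)}_{(M)j})}{\delta T^A}$; $R^{(m)}_{(M)ij}=\frac{\delta^{\mathbf J}({}^{\mathbf b}N^{(m)}_{(M)i})}{\delta x^j}-\frac{\delta^{\mathbf J}({}^{\mathbf b}N^{(m)}_{(M)j})}{\delta x^i}$. (E.g. $T^M_{AB}$ and $R^{(m)}_{(M)AB}$ are the $\frac{\delta^{\mathbf J}}{\delta T^M}$- and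 $\frac{\partial}{\partial X^m_M}$-components of the torsion evaluated on $(\frac{\delta^{\mathbf J}}{\delta T^B},\frac{\delta^{\mathbf J}}{\delta T^A})$.) In the claim each capital index is split into its Greek and Latin parts. *)

theory Defs
  imports "HOL-Analysis.Analysis"
begin

section \<open>Calculus on open subsets of coordinate space\<close>

text \<open>The partial derivative in the coordinate with index \<open>k\<close>.\<close>

definition pd :: "'k::finite \<Rightarrow> (real^'k \<Rightarrow> real) \<Rightarrow> real^'k \<Rightarrow> real" where
  "pd k f z = deriv (\<lambda>h::real. f (z + h *\<^sub>R axis k 1)) 0"

text \<open>Only used on open sets \<open>S\<close>.\<close>

primrec Ck_on :: "nat \<Rightarrow> (real^'k) set \<Rightarrow> (real^'k::finite \<Rightarrow> real) \<Rightarrow> bool" where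
  "Ck_on 0 S f \<longleftrightarrow> continuous_on S f"
| "Ck_on (Suc r) S f \<longleftrightarrow> f differentiable_on S \<and> (\<forall>i. Ck_on r S (pd i f))"

definition smooth_on :: "(real^'k) set \<Rightarrow> (real^'k::finite \<Rightarrow> real) \<Rightarrow> bool" where
  "smooth_on S f \<longleftrightarrow> (\<forall>r. Ck_on r S f)"

type_synonym 'k vfield = "real^'k \<Rightarrow> real^'k"

definition smooth_vfield :: "(real^'k) set \<Rightarrow> 'k::finite vfield \<Rightarrow> bool" where
  "smooth_vfield S X \<longleftrightarrow> (\<forall>k. smooth_on S (\<lambda>z. X z $ k))"

definition vf_apply :: "'k::finite vfield \<Rightarrow> (real^'k \<Rightarrow> real) \<Rightarrow> real^'k \<Rightarrow> real" where
  "vf_apply X f z = (\<Sum>l\<in>UNIV. X z $ l * pd l f z)"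

definition lie_bracket :: "'k::finite vfield \<Rightarrow> 'k vfield \<Rightarrow> 'k vfield" where
  "lie_bracket X Y z =
     (\<chi> k. vf_apply X (\<lambda>w. Y w $ k) z - vf_apply Y (\<lambda>w. X w $ k) z)"

definition coord_field :: "'k::finite \<Rightarrow> 'k vfield" where
  "coord_field k z = axis k 1"

text \<open>\<open>D X Y\<close> is the covariant derivative of \<open>Y\<close> in the direction \<open>X\<close>; only its values at
  points of the open set \<open>S\<close> and on fields that are smooth on \<open>S\<close> matter.\<close>

definition linear_connection ::
  "(real^'k) set \<Rightarrow> ('k::finite vfield \<Rightarrow> 'k vfield \<Rightarrow> 'k vfield) \<Rightarrow> bool" where
  "linear_connection S D \<longleftrightarrow>
     (\<forall>X Y. smooth_vfield S X \<and> smooth_vfield S Y \<longrightarrow> smooth_vfield S (D X Y)) \<and>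
     (\<forall>X X' Y. smooth_vfield S X \<and> smooth_vfield S X' \<and> smooth_vfield S Y \<longrightarrow>
        (\<forall>z\<in>S. D (\<lambda>w. X w + X' w) Y z = D X Y z + D X' Y z)) \<and>
     (\<forall>X Y Y'. smooth_vfield S X \<and> smooth_vfield S Y \<and> smooth_vfield S Y' \<longrightarrow>
        (\<forall>z\<in>S. D X (\<lambda>w. Y w + Y' w) z = D X Y z + D X Y' z)) \<and>
     (\<forall>f X Y. smooth_on S f \<and> smooth_vfield S X \<and> smooth_vfield S Y \<longrightarrow>
        (\<forall>z\<in>S. D (\<lambda>w. f w *\<^sub>R X w) Y z = f z *\<^sub>R D X Y z)) \<and>
     (\<forall>f X Y. smooth_on S f \<and> smooth_vfield S X \<and> smooth_vfield S Y \<longrightarrow>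
        (\<forall>z\<in>S. D X (\<lambda>w. f w *\<^sub>R Y w) z = vf_apply X f z *\<^sub>R Y z + f z *\<^sub>R D X Y z))"

definition torsion ::
  "('k::finite vfield \<Rightarrow> 'k vfield \<Rightarrow> 'k vfield) \<Rightarrow> 'k vfield \<Rightarrow> 'k vfield \<Rightarrow> 'k vfield" where
  "torsion D X Y z = D X Y z - D Y X z - lie_bracket X Y z"

text \<open>The components of the vector \<open>v\<close> in the basis \<open>e\<close>.\<close>

definition basis_comp :: "('k \<Rightarrow> real^'k) \<Rightarrow> real^'k::finite \<Rightarrow> real^'k" where
  "basis_comp e v = (THE c. v = (\<Sum>k\<in>UNIV. (c $ k) *\<^sub>R e k))"


section \<open>Finsler manifolds\<close>

text \<open>A manifold is a Hausdorff, second countable type \<open>'m\<close> with a smooth atlas of charts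
  \<open>(U, \<phi>)\<close>; the dimension is \<open>CARD('p)\<close>.\<close>

type_synonym ('m, 'p) chart = "'m set \<times> ('m \<Rightarrow> real^'p)"

definition chart_image :: "('m, 'p::finite) chart \<Rightarrow> (real^'p) set" where
  "chart_image c = snd c ` fst c"

definition chart_inv :: "('m, 'p::finite) chart \<Rightarrow> real^'p \<Rightarrow> 'm" where
  "chart_inv c = inv_into (fst c) (snd c)"

definition transition :: "('m, 'p::finite) chart \<Rightarrow> ('m, 'p) chart \<Rightarrow> real^'p \<Rightarrow> real^'p" where
  "transition c d x = snd d (chart_inv c x)"

definition smooth_atlas ::
  "('m::{t2_space,second_countable_topology}, 'p::finite) chart set \<Rightarrow> bool" where
  "smooth_atlas \<A> \<longleftrightarrow>
     (\<Union>c\<in>\<A>. fst c) = UNIV \<and>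
     (\<forall>c\<in>\<A>. open (fst c) \<and> open (chart_image c) \<and>
        homeomorphism (fst c) (chart_image c) (snd c) (chart_inv c)) \<and>
     (\<forall>c\<in>\<A>. \<forall>d\<in>\<A>. \<forall>i. smooth_on (snd c ` (fst c \<inter> fst d)) (\<lambda>x. transition c d x $ i))"

text \<open>A tangent vector at \<open>m\<close> is the family of its coordinate vectors in the charts around
  \<open>m\<close>, related by the differentials of the transition maps (and set to 0 at all other pairs).\<close>

definition tangent_space ::
  "('m, 'p::finite) chart set \<Rightarrow> 'm \<Rightarrow> (('m, 'p) chart \<Rightarrow> real^'p) set" where
  "tangent_space \<A> m =
     {v. (\<forall>c\<in>\<A>. \<forall>d\<in>\<A>. m \<in> fst c \<inter> fst d \<longrightarrow>
            v d = frechet_derivative (transition c d) (at (snd c m)) (v c)) \<and>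
         (\<forall>c. c \<notin> \<A> \<or> m \<notin> fst c \<longrightarrow> v c = 0)}"

definition tangent_bundle ::
  "('m, 'p::finite) chart set \<Rightarrow> ('m \<times> (('m, 'p) chart \<Rightarrow> real^'p)) set" where
  "tangent_bundle \<A> = Sigma UNIV (tangent_space \<A>)"

text \<open>Points of the coordinate space of the tangent bundle are vectors indexed by \<open>'p + 'p\<close>:
  \<open>Inl \<alpha>\<close> is the index of the base coordinate \<open>t\<^sup>\<alpha>\<close> and \<open>Inr a\<close> that of the fibre
  coordinate \<open>s\<^sup>a\<close>. The sum type is thus also the range of the capital indices \<open>A = (\<alpha>, a)\<close>.\<close>

definition base_part :: "real^('p + 'p) \<Rightarrow> real^'p::finite" where
  "base_part T = (\<chi> \<alpha>. T $ Inl \<alpha>)"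

definition fibre_part :: "real^('p + 'p) \<Rightarrow> real^'p::finite" where
  "fibre_part T = (\<chi> a. T $ Inr a)"

definition slit_domain :: "('m, 'p::finite) chart \<Rightarrow> (real^('p + 'p)) set" where
  "slit_domain c = {T. base_part T \<in> chart_image c \<and> fibre_part T \<noteq> 0}"

definition induced_coords ::
  "('m, 'p::finite) chart \<Rightarrow> 'm \<times> (('m, 'p) chart \<Rightarrow> real^'p) \<Rightarrow> real^('p + 'p)" where
  "induced_coords c w =
     (\<chi> A. case A of Inl \<alpha> \<Rightarrow> snd c (fst w) $ \<alpha> | Inr a \<Rightarrow> snd w c $ a)"

text \<open>The expression of a function on the tangent bundle in the coordinates induced by \<open>c\<close>.\<close>

definition local_rep ::
  "('m, 'p::finite) chart set \<Rightarrow> ('m, 'p) chart \<Rightarrow>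
     ('m \<times> (('m, 'p) chart \<Rightarrow> real^'p) \<Rightarrow> real) \<Rightarrow> real^('p + 'p) \<Rightarrow> real" where
  "local_rep \<A> c F T =
     F (inv_into {w \<in> tangent_bundle \<A>. fst w \<in> fst c} (induced_coords c) T)"

text \<open>From here on \<open>L\<close> stands for the expression of a Finsler function in induced coordinates.\<close>

definition fund :: "(real^('p + 'p) \<Rightarrow> real) \<Rightarrow> 'p::finite \<Rightarrow> 'p \<Rightarrow> real^('p + 'p) \<Rightarrow> real" where
  "fund L \<alpha> \<beta> T = 1/2 * pd (Inr \<alpha>) (pd (Inr \<beta>) (\<lambda>W. (L W)\<^sup>2)) T"

definition finsler_manifold ::
  "('m::{t2_space,second_countable_topology}, 'p::finite) chart set \<Rightarrow>
     ('m \<times> (('m, 'p) chart \<Rightarrow> real^'p) \<Rightarrow> real) \<Rightarrow> bool" where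
  "finsler_manifold \<A> F \<longleftrightarrow>
     smooth_atlas \<A> \<and>
     (\<forall>w\<in>tangent_bundle \<A>. F w \<ge> 0) \<and>
     (\<forall>c\<in>\<A>. smooth_on (slit_domain c) (local_rep \<A> c F)) \<and>
     (\<forall>(m, v)\<in>tangent_bundle \<A>. \<forall>r>0. F (m, \<lambda>c. r *\<^sub>R v c) = r * F (m, v)) \<and>
     (\<forall>c\<in>\<A>. \<forall>T\<in>slit_domain c. \<forall>u::real^'p. u \<noteq> 0 \<longrightarrow>
        (\<Sum>\<alpha>\<in>UNIV. \<Sum>\<beta>\<in>UNIV. fund (local_rep \<A> c F) \<alpha> \<beta> T * u $ \<alpha> * u $ \<beta>) > 0)"

definition fund_inv ::
  "(real^('p + 'p) \<Rightarrow> real) \<Rightarrow> 'p::finite \<Rightarrow> 'p \<Rightarrow> real^('p + 'p) \<Rightarrow> real" where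
  "fund_inv L \<mu> \<epsilon> T = matrix_inv (\<chi> \<alpha> \<beta>. fund L \<alpha> \<beta> T) $ \<mu> $ \<epsilon>"

text \<open>In the following arrays the upper index always comes first.\<close>

definition christoffel ::
  "(real^('p + 'p) \<Rightarrow> real) \<Rightarrow> 'p::finite \<Rightarrow> 'p \<Rightarrow> 'p \<Rightarrow> real^('p + 'p) \<Rightarrow> real" where
  "christoffel L \<mu> \<alpha> \<beta> T =
     (\<Sum>\<epsilon>\<in>UNIV. fund_inv L \<mu> \<epsilon> T / 2 *
        (pd (Inl \<beta>) (fund L \<epsilon> \<alpha>) T + pd (Inl \<alpha>) (fund L \<epsilon> \<beta>) T - pd (Inl \<epsilon>) (fund L \<alpha> \<beta>) T))"

definition spray :: "(real^('p + 'p) \<Rightarrow> real) \<Rightarrow> 'p::finite \<Rightarrow> real^('p + 'p) \<Rightarrow> real" where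
  "spray L \<mu> T =
     1/2 * (\<Sum>\<alpha>\<in>UNIV. \<Sum>\<beta>\<in>UNIV. christoffel L \<mu> \<alpha> \<beta> T * T $ Inr \<alpha> * T $ Inr \<beta>)"

definition Nl :: "(real^('p + 'p) \<Rightarrow> real) \<Rightarrow> 'p::finite \<Rightarrow> 'p \<Rightarrow> real^('p + 'p) \<Rightarrow> real" where
  "Nl L \<gamma> \<alpha> = pd (Inr \<alpha>) (spray L \<gamma>)"

definition Bw ::
  "(real^('p + 'p) \<Rightarrow> real) \<Rightarrow> 'p::finite \<Rightarrow> 'p \<Rightarrow> 'p \<Rightarrow> real^('p + 'p) \<Rightarrow> real" where
  "Bw L \<gamma> \<alpha> \<beta> = pd (Inr \<alpha>) (pd (Inr \<beta>) (spray L \<gamma>))"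

definition delta_t ::
  "(real^('p + 'p) \<Rightarrow> real) \<Rightarrow> 'p::finite \<Rightarrow> (real^('p + 'p) \<Rightarrow> real) \<Rightarrow> real^('p + 'p) \<Rightarrow> real" where
  "delta_t L \<alpha> f T = pd (Inl \<alpha>) f T - (\<Sum>\<epsilon>\<in>UNIV. Nl L \<epsilon> \<alpha> T * pd (Inr \<epsilon>) f T)"

definition RN ::
  "(real^('p + 'p) \<Rightarrow> real) \<Rightarrow> 'p::finite \<Rightarrow> 'p \<Rightarrow> 'p \<Rightarrow> real^('p + 'p) \<Rightarrow> real" where
  "RN L \<alpha> \<beta> \<gamma> T = delta_t L \<gamma> (Nl L \<alpha> \<beta>) T - delta_t L \<beta> (Nl L \<alpha> \<gamma>) T"

definition RB ::
  "(real^('p + 'p) \<Rightarrow> real) \<Rightarrow> 'p::finite \<Rightarrow> 'p \<Rightarrow> 'p \<Rightarrow> 'p \<Rightarrow> real^('p + 'p) \<Rightarrow> real" where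
  "RB L \<alpha> \<beta> \<gamma> \<epsilon> T =
     delta_t L \<epsilon> (Bw L \<alpha> \<beta> \<gamma>) T - delta_t L \<gamma> (Bw L \<alpha> \<beta> \<epsilon>) T +
     (\<Sum>\<mu>\<in>UNIV. Bw L \<mu> \<beta> \<gamma> T * Bw L \<alpha> \<mu> \<epsilon> T - Bw L \<mu> \<beta> \<epsilon> T * Bw L \<alpha> \<mu> \<gamma> T)"

definition PB ::
  "(real^('p + 'p) \<Rightarrow> real) \<Rightarrow> 'p::finite \<Rightarrow> 'p \<Rightarrow> 'p \<Rightarrow> 'p \<Rightarrow> real^('p + 'p) \<Rightarrow> real" where
  "PB L \<alpha> \<beta> \<gamma> \<epsilon> = pd (Inr \<epsilon>) (Bw L \<alpha> \<beta> \<gamma>)"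

text \<open>\<open>Ncol L c \<alpha> \<beta>\<close> is \<open>N\<close> with upper index \<open>c\<close> and lower indices \<open>\<alpha> : \<beta>\<close>.\<close>

definition Ncol ::
  "(real^('p + 'p) \<Rightarrow> real) \<Rightarrow> 'p::finite \<Rightarrow> 'p \<Rightarrow> 'p \<Rightarrow> real^('p + 'p) \<Rightarrow> real" where
  "Ncol L c \<alpha> \<beta> T =
     pd (Inl \<beta>) (Nl L c \<alpha>) T + (\<Sum>d\<in>UNIV. Nl L d \<alpha> T * Bw L c d \<beta> T)
       - (\<Sum>\<gamma>\<in>UNIV. Nl L c \<gamma> T * Bw L \<gamma> \<alpha> \<beta> T)"


section \<open>The Berwald connection on the slit tangent bundle\<close>

definition delta_field :: "(real^('p + 'p) \<Rightarrow> real) \<Rightarrow> 'p::finite \<Rightarrow> ('p + 'p) vfield" where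
  "delta_field L \<alpha> T =
     coord_field (Inl \<alpha>) T - (\<Sum>\<epsilon>\<in>UNIV. Nl L \<epsilon> \<alpha> T *\<^sub>R coord_field (Inr \<epsilon>) T)"

definition berwald_connection ::
  "(real^('p + 'p)) set \<Rightarrow> (real^('p + 'p) \<Rightarrow> real) \<Rightarrow>
     (('p::finite + 'p) vfield \<Rightarrow> ('p + 'p) vfield \<Rightarrow> ('p + 'p) vfield) \<Rightarrow> bool" where
  "berwald_connection S L nabla \<longleftrightarrow>
     linear_connection S nabla \<and>
     (\<forall>T\<in>S.
       (\<forall>\<alpha> \<beta>. nabla (delta_field L \<beta>) (delta_field L \<alpha>) T =
          (\<Sum>\<gamma>\<in>UNIV. Bw L \<gamma> \<alpha> \<beta> T *\<^sub>R delta_field L \<gamma> T)) \<and>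
       (\<forall>a \<beta>. nabla (delta_field L \<beta>) (coord_field (Inr a)) T =
          (\<Sum>c\<in>UNIV. Bw L c a \<beta> T *\<^sub>R coord_field (Inr c) T)) \<and>
       (\<forall>\<alpha> b. nabla (coord_field (Inr b)) (delta_field L \<alpha>) T = 0) \<and>
       (\<forall>a b. nabla (coord_field (Inr b)) (coord_field (Inr a)) T = 0))"

text \<open>The second lower index is the direction of differentiation.\<close>

definition conn_coeff ::
  "('k::finite vfield \<Rightarrow> 'k vfield \<Rightarrow> 'k vfield) \<Rightarrow> 'k \<Rightarrow> 'k \<Rightarrow> 'k \<Rightarrow> real^'k \<Rightarrow> real" where
  "conn_coeff nabla C A B T = nabla (coord_field B) (coord_field A) T $ C"


section \<open>The jet space and the jet Berwald linear d-connection\<close>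

text \<open>Index type for the coordinates \<open>T\<^sup>A\<close>, \<open>x\<^sup>i\<close> and \<open>X\<close> (lower index \<open>A\<close>, upper index \<open>i\<close>).\<close>

type_synonym ('p, 'n) jidx = "('p + 'p) + ('n + (('p + 'p) \<times> 'n))"

type_synonym ('p, 'n) jet = "real^('p, 'n) jidx"

abbreviation iT :: "'p + 'p \<Rightarrow> ('p, 'n) jidx" where
  "iT A \<equiv> Inl A"

abbreviation ix :: "'n \<Rightarrow> ('p, 'n) jidx" where
  "ix i \<equiv> Inr (Inl i)"

abbreviation iX :: "'p + 'p \<Rightarrow> 'n \<Rightarrow> ('p, 'n) jidx" where
  "iX A i \<equiv> Inr (Inr (A, i))"

abbreviation s_coord :: "('p::finite, 'n::finite) jet \<Rightarrow> 'p \<Rightarrow> real" where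
  "s_coord z a \<equiv> z $ iT (Inr a)"

abbreviation x_jet :: "('p::finite, 'n::finite) jet \<Rightarrow> 'n \<Rightarrow> 'p \<Rightarrow> real" where
  "x_jet z i \<alpha> \<equiv> z $ iX (Inl \<alpha>) i"

abbreviation y_jet :: "('p::finite, 'n::finite) jet \<Rightarrow> 'n \<Rightarrow> 'p \<Rightarrow> real" where
  "y_jet z i a \<equiv> z $ iX (Inr a) i"

definition jet_source :: "('p::finite, 'n::finite) jet \<Rightarrow> real^('p + 'p)" where
  "jet_source z = (\<chi> A. z $ iT A)"

text \<open>The point of the tangent bundle of the target at which the tilded functions are evaluated.\<close>

definition jet_target :: "('p::finite, 'n::finite) jet \<Rightarrow> real^('n + 'n)" where
  "jet_target z =
     (\<chi> k. case k of Inl l \<Rightarrow> z $ ix l | Inr l \<Rightarrow> (\<Sum>a\<in>UNIV. y_jet z l a * s_coord z a))"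

definition jet_domain ::
  "('m, 'p::finite) chart \<Rightarrow> ('q, 'n::finite) chart \<Rightarrow> ('p, 'n) jet set" where
  "jet_domain c d = {z. jet_source z \<in> slit_domain c \<and> jet_target z \<in> slit_domain d}"

text \<open>\<open>\<Gamma>\<close> are the coefficients of a linear connection on the slit tangent bundle of the source
  and \<open>L'\<close> is the expression of the Finsler function of the target.\<close>

definition jetM ::
  "('p + 'p \<Rightarrow> 'p + 'p \<Rightarrow> 'p + 'p \<Rightarrow> real^('p + 'p) \<Rightarrow> real) \<Rightarrow>
     'n \<Rightarrow> 'p + 'p \<Rightarrow> 'p + 'p \<Rightarrow> ('p::finite, 'n::finite) jet \<Rightarrow> real" where
  "jetM \<Gamma> j B A z = - (\<Sum>C\<in>UNIV. \<Gamma> C A B (jet_source z) * z $ iX C j)"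

definition jetN ::
  "(real^('n + 'n) \<Rightarrow> real) \<Rightarrow> 'n \<Rightarrow> 'p + 'p \<Rightarrow> 'n \<Rightarrow> ('p::finite, 'n::finite) jet \<Rightarrow> real" where
  "jetN L' j B i z = (\<Sum>k\<in>UNIV. Bw L' j i k (jet_target z) * z $ iX B k)"

definition adapted_T ::
  "('p + 'p \<Rightarrow> 'p + 'p \<Rightarrow> 'p + 'p \<Rightarrow> real^('p + 'p) \<Rightarrow> real) \<Rightarrow>
     'p + 'p \<Rightarrow> ('p::finite, 'n::finite) jidx vfield" where
  "adapted_T \<Gamma> A z =
     coord_field (iT A) z - (\<Sum>B\<in>UNIV. \<Sum>j\<in>UNIV. jetM \<Gamma> j B A z *\<^sub>R coord_field (iX B j) z)"

definition adapted_x ::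
  "(real^('n + 'n) \<Rightarrow> real) \<Rightarrow> 'n \<Rightarrow> ('p::finite, 'n::finite) jidx vfield" where
  "adapted_x L' i z =
     coord_field (ix i) z - (\<Sum>B\<in>UNIV. \<Sum>j\<in>UNIV. jetN L' j B i z *\<^sub>R coord_field (iX B j) z)"

definition adapted_X :: "'p + 'p \<Rightarrow> 'n \<Rightarrow> ('p::finite, 'n::finite) jidx vfield" where
  "adapted_X A i = coord_field (iX A i)"

definition adapted_basis ::
  "('p + 'p \<Rightarrow> 'p + 'p \<Rightarrow> 'p + 'p \<Rightarrow> real^('p + 'p) \<Rightarrow> real) \<Rightarrow> (real^('n + 'n) \<Rightarrow> real) \<Rightarrow>
     ('p::finite, 'n::finite) jidx \<Rightarrow> ('p, 'n) jidx vfield" where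
  "adapted_basis \<Gamma> L' K =
     (case K of Inl A \<Rightarrow> adapted_T \<Gamma> A
        | Inr (Inl i) \<Rightarrow> adapted_x L' i
        | Inr (Inr (A, i)) \<Rightarrow> adapted_X A i)"

definition jet_berwald_connection ::
  "('p::finite, 'n::finite) jet set \<Rightarrow>
     ('p + 'p \<Rightarrow> 'p + 'p \<Rightarrow> 'p + 'p \<Rightarrow> real^('p + 'p) \<Rightarrow> real) \<Rightarrow> (real^('n + 'n) \<Rightarrow> real) \<Rightarrow>
     (('p, 'n) jidx vfield \<Rightarrow> ('p, 'n) jidx vfield \<Rightarrow> ('p, 'n) jidx vfield) \<Rightarrow> bool" where
  "jet_berwald_connection S \<Gamma> L' D \<longleftrightarrow>
     linear_connection S D \<and>
     (\<forall>z\<in>S.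
       (\<forall>B C. D (adapted_T \<Gamma> C) (adapted_T \<Gamma> B) z =
          (\<Sum>A\<in>UNIV. \<Gamma> A B C (jet_source z) *\<^sub>R adapted_T \<Gamma> A z)) \<and>
       (\<forall>i C. D (adapted_T \<Gamma> C) (adapted_x L' i) z = 0) \<and>
       (\<forall>j B C. D (adapted_T \<Gamma> C) (adapted_X B j) z =
          (\<Sum>i\<in>UNIV. \<Sum>A\<in>UNIV.
             (- (if i = j then 1 else 0) * \<Gamma> B C A (jet_source z)) *\<^sub>R adapted_X A i z)) \<and>
       (\<forall>j B. D (adapted_x L' j) (adapted_T \<Gamma> B) z = 0) \<and>
       (\<forall>i j. D (adapted_x L' j) (adapted_x L' i) z =
          (\<Sum>k\<in>UNIV. Bw L' k i j (jet_target z) *\<^sub>R adapted_x L' k z)) \<and>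
       (\<forall>j k B. D (adapted_x L' k) (adapted_X B j) z =
          (\<Sum>i\<in>UNIV. \<Sum>A\<in>UNIV.
             ((if B = A then 1 else 0) * Bw L' i j k (jet_target z)) *\<^sub>R adapted_X A i z)) \<and>
       (\<forall>k C K. D (adapted_X C k) (adapted_basis \<Gamma> L' K) z = 0))"

text \<open>\<open>d_torsion \<Gamma> L' D U K H\<close> is the component with upper index \<open>U\<close> of the torsion evaluated on
  the adapted basis fields with indices \<open>(H, K)\<close>, in this order. The naming of the d-torsions is

    \<^item> \<open>U = iT M\<close>, \<open>K = iT A\<close>, \<open>H = iT B\<close>: \<open>T\<close> with upper index \<open>M\<close> and lower indices \<open>A B\<close>;
    \<^item> \<open>U = iX M m\<close>: the \<open>P\<close>'s and \<open>R\<close>'s with upper index \<open>(m)\<close>, lower index \<open>(M)\<close> and then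
      the indices of \<open>K\<close>, \<open>H\<close>; they are the \<open>P\<close>'s if \<open>H = iX B j\<close> and the \<open>R\<close>'s otherwise.

  With this order they are \<open>\<Gamma> M A B - \<Gamma> M B A\<close>, \<open>\<partial>M/\<partial>X - G\<close>, \<open>\<partial>N/\<partial>X - L\<close>, and the differences
  of the adapted derivative along \<open>H\<close> of the coefficient belonging to \<open>K\<close> and vice versa.\<close>

definition d_torsion ::
  "('p + 'p \<Rightarrow> 'p + 'p \<Rightarrow> 'p + 'p \<Rightarrow> real^('p + 'p) \<Rightarrow> real) \<Rightarrow> (real^('n + 'n) \<Rightarrow> real) \<Rightarrow>
     (('p, 'n) jidx vfield \<Rightarrow> ('p, 'n) jidx vfield \<Rightarrow> ('p, 'n) jidx vfield) \<Rightarrow>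
     ('p, 'n) jidx \<Rightarrow> ('p, 'n) jidx \<Rightarrow> ('p, 'n) jidx \<Rightarrow> ('p::finite, 'n::finite) jet \<Rightarrow> real" where
  "d_torsion \<Gamma> L' D U K H z =
     basis_comp (\<lambda>I. adapted_basis \<Gamma> L' I z)
       (torsion D (adapted_basis \<Gamma> L' H) (adapted_basis \<Gamma> L' K) z) $ U"

text \<open>The index patterns \<open>(U, K, H)\<close> of the families that need not vanish. Greek parts of capital
  indices are \<open>Inl\<close>, Latin parts are \<open>Inr\<close>.\<close>

inductive nonvanishing_family ::
  "('p, 'n) jidx \<Rightarrow> ('p, 'n) jidx \<Rightarrow> ('p, 'n) jidx \<Rightarrow> bool" where
  "nonvanishing_family (iT (Inr a)) (iT (Inl \<beta>)) (iT (Inl \<gamma>))"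
| "nonvanishing_family (iX (Inl \<mu>) m) (ix i) (iX (Inr b) j)"
| "nonvanishing_family (iX (Inr c) m) (ix i) (iX (Inr b) j)"
| "nonvanishing_family (iX (Inl \<mu>) m) (iT (Inl \<alpha>)) (iT (Inl \<beta>))"
| "nonvanishing_family (iX (Inl \<mu>) m) (iT (Inl \<alpha>)) (iT (Inr b))"
| "nonvanishing_family (iX (Inl \<mu>) m) (iT (Inr a)) (iT (Inl \<beta>))"
| "nonvanishing_family (iX (Inr c) m) (iT (Inl \<alpha>)) (iT (Inl \<beta>))"
| "nonvanishing_family (iX (Inr c) m) (iT (Inl \<alpha>)) (iT (Inr b))"
| "nonvanishing_family (iX (Inr c) m) (iT (Inr a)) (iT (Inl \<beta>))"
| "nonvanishing_family (iX (Inl \<mu>) m) (iT (Inl \<alpha>)) (ix j)"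
| "nonvanishing_family (iX (Inl \<mu>) m) (iT (Inr a)) (ix j)"
| "nonvanishing_family (iX (Inr c) m) (iT (Inl \<alpha>)) (ix j)"
| "nonvanishing_family (iX (Inr c) m) (iT (Inr a)) (ix j)"
| "nonvanishing_family (iX (Inl \<mu>) m) (ix i) (ix j)"
| "nonvanishing_family (iX (Inr c) m) (ix i) (ix j)"

definition alt_sum :: "('i \<Rightarrow> 'i \<Rightarrow> real) \<Rightarrow> 'i \<Rightarrow> 'i \<Rightarrow> real" where
  "alt_sum Z \<alpha> \<beta> = Z \<alpha> \<beta> - Z \<beta> \<alpha>"

end

theory Submission
  imports Defs
begin

text \<open>An adapted basis field is a coordinate field corrected by vertical fields, so the bracket of
  two of them is vertical and its components are differences of adapted derivatives of the
  nonlinear connection. Since the adapted basis fields are given explicitly, the torsion of two of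
  them is a combination of the connection coefficients and these differences. The connection
  coefficients of the source are smooth because the inverse of the positive definite fundamental
  tensor is, and they are computed from the values on the horizontal frame with the Leibniz rule.
  What remains is algebra, which uses that the Berwald coefficients are symmetric in the lower
  indices and their fibre derivatives in all three, by Schwarz's theorem for the spray.\<close>

section \<open>Partial derivatives and smooth functions\<close>

text \<open>The obstacle is that a connection on the source is only controlled at points of the slit
  domain and on fields smooth there. Hence \<open>Nl\<close> has to be known smooth before the
  Leibniz rule may be applied to a coordinate field, and the formulas for \<open>conn_coeff\<close>
  have to hold on the whole open domain before they are differentiated. On the jet space the torsion
  of two adapted fields involves the prescribed values of \<open>D\<close> and first derivatives of
  the frame coefficients at the single point \<open>z\<close>. It is computed with unsplit capital
  indices, where the structural cancellations are visible; the split into Greek and Latin parts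
  comes last. Two mechanisms produce the surviving vertical components: a nonlinear connection
  linear in the jet variables has a curvature of the usual linear form, and the target coefficients
  depend on the jet through the fibre point y s.\<close>

lemma line_field_derivative:
  fixes f :: "real^'k::finite \<Rightarrow> real"
  assumes "(f has_derivative f') (at (c + x *\<^sub>R v))"
  shows "((\<lambda>h. f (c + h *\<^sub>R v)) has_real_derivative f' v) (at x)"
proof -
  interpret bounded_linear f' using assms by (rule has_derivative_bounded_linear)
  have "((\<lambda>h::real. c + h *\<^sub>R v) has_derivative (\<lambda>h. h *\<^sub>R v)) (at x)"
    by (auto intro!: derivative_eq_intros)
  from has_derivative_compose[OF this assms]
  have "((\<lambda>h. f (c + h *\<^sub>R v)) has_derivative (\<lambda>h. f' (h *\<^sub>R v))) (at x)" .
  then show ?thesis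
    by (rule has_derivative_imp_has_field_derivative) (simp add: scale)
qed

lemma pd_has_derivative:
  fixes f :: "real^'k::finite \<Rightarrow> real"
  assumes "(f has_derivative f') (at z)"
  shows "pd k f z = f' (axis k 1)"
  unfolding pd_def
  by (rule DERIV_imp_deriv) (use line_field_derivative[of f f' z 0 "axis k 1"] assms in simp)

lemma has_derivative_pd:
  fixes f :: "real^'k::finite \<Rightarrow> real"
  assumes "f differentiable (at z)"
  shows "(f has_derivative (\<lambda>v. \<Sum>k\<in>UNIV. v $ k * pd k f z)) (at z)"
proof -
  obtain f' where f': "(f has_derivative f') (at z)"
    using assms by (auto simp: differentiable_def)
  interpret bounded_linear f' using f' by (rule has_derivative_bounded_linear)
  have "f' v = (\<Sum>k\<in>UNIV. v $ k * pd k f z)" for v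
  proof -
    have "f' v = f' (\<Sum>k\<in>UNIV. v $ k *\<^sub>R axis k 1)"
      by (simp add: basis_expansion scalar_mult_eq_scaleR[symmetric])
    then show ?thesis by (simp add: sum scale pd_has_derivative[OF f'])
  qed
  then have "f' = (\<lambda>v. \<Sum>k\<in>UNIV. v $ k * pd k f z)" by blast
  with f' show ?thesis by simp
qed

text \<open>By uniqueness of the derivative, any formula found with the
  \<open>has_derivative\<close> rules may be used. Products and compositions on the jet space can
  thus be differentiated along a frame field without going through single partial
  derivatives.\<close>

lemma vf_apply_has_derivative:
  assumes "(f has_derivative f') (at z)"
  shows "vf_apply X f z = f' (X z)"
proof -
  have "f differentiable (at z)" using assms by (auto simp: differentiable_def)
  from has_derivative_pd[OF this] have "f' = (\<lambda>v. \<Sum>k\<in>UNIV. v $ k * pd k f z)"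
    using assms by (rule has_derivative_unique[rotated])
  then show ?thesis by (simp add: vf_apply_def)
qed

lemma line_derivative:
  fixes f :: "real^'k::finite \<Rightarrow> real"
  assumes "f differentiable (at (c + x *\<^sub>R axis k 1))"
  shows "((\<lambda>h. f (c + h *\<^sub>R axis k 1)) has_real_derivative pd k f (c + x *\<^sub>R axis k 1)) (at x)"
proof -
  obtain f' where f': "(f has_derivative f') (at (c + x *\<^sub>R axis k 1))"
    using assms by (auto simp: differentiable_def)
  show ?thesis using line_field_derivative[OF f'] by (simp add: pd_has_derivative[OF f'])
qed

text \<open>For small steps the line through \<open>z\<close> stays in the open set. This is what
  allows formulas that are valid only on a domain to be differentiated.\<close>

lemma pd_cong:
  fixes f :: "real^'k::finite \<Rightarrow> real"
  assumes S: "open S" "z \<in> S" and eq: "\<And>w. w \<in> S \<Longrightarrow> f w = g w"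
  shows "pd k f z = pd k g z"
  unfolding pd_def
proof (rule deriv_cong_ev)
  have "((\<lambda>h::real. z + h *\<^sub>R axis k (1::real)) \<longlongrightarrow> z + 0 *\<^sub>R axis k 1) (nhds 0)"
    by (intro tendsto_intros) (simp add: filterlim_ident)
  then have "\<forall>\<^sub>F h in nhds 0. z + h *\<^sub>R axis k 1 \<in> S"
    by (rule topological_tendstoD) (use S in auto)
  then show "\<forall>\<^sub>F h in nhds 0. f (z + h *\<^sub>R axis k 1) = g (z + h *\<^sub>R axis k 1)"
    by eventually_elim (rule eq)
qed simp

section \<open>Functions of class C^k on open sets\<close>

lemma differentiable_at_open:
  assumes "f differentiable_on S" "open S" "z \<in> S"
  shows "f differentiable (at z)"
  using assms by (metis differentiable_on_def at_within_open)

lemma Ck_on_cong: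
  assumes "open S" "\<And>w. w \<in> S \<Longrightarrow> f w = g w" "Ck_on r S f"
  shows "Ck_on r S g"
  using assms(2,3)
proof (induction r arbitrary: f g)
  case 0
  then show ?case by (auto cong: continuous_on_cong)
next
  case (Suc r)
  have "g differentiable_on S"
    unfolding differentiable_on_def
  proof
    fix z assume z: "z \<in> S"
    have "f differentiable (at z within S)"
      using Suc.prems z by (simp add: differentiable_on_def)
    then show "g differentiable (at z within S)"
      by (rule differentiable_transform_within[OF _ zero_less_one z Suc.prems(1)])
  qed
  moreover have "Ck_on r S (pd i g)" for i
  proof (rule Suc.IH)
    show "pd i f w = pd i g w" if "w \<in> S" for w
      by (rule pd_cong[OF assms(1) that Suc.prems(1)])
  qed (use Suc.prems in simp)
  ultimately show ?case by simp
qed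

lemma Ck_on_SucD: "Ck_on (Suc r) S f \<Longrightarrow> Ck_on r S f"
  by (induction r arbitrary: f) (auto intro: differentiable_imp_continuous_on)

lemma Ck_on_const: "Ck_on r S (\<lambda>_. c)"
  for S :: "(real^'k::finite) set"
proof (induction r arbitrary: c)
  case (Suc r)
  have "pd i (\<lambda>_::real^'k. c) = (\<lambda>_. 0)" for i by (auto simp: pd_def)
  with Suc show ?case by simp
qed simp

lemma sum_axis_mult: "(\<Sum>k\<in>UNIV. axis i 1 $ k * f k) = f i"
  for f :: "'k::finite \<Rightarrow> real"
proof -
  have "(\<Sum>k\<in>UNIV. axis i 1 $ k * f k) = (\<Sum>k\<in>UNIV. if k = i then f k else 0)"
    by (intro sum.cong) (auto simp: axis_def)
  then show ?thesis by simp
qed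

lemma pd_add:
  assumes "f differentiable (at z)" "g differentiable (at z)"
  shows "pd k (\<lambda>z. f z + g z) z = pd k f z + pd k g z"
  using pd_has_derivative[OF has_derivative_add[OF has_derivative_pd[OF assms(1)] has_derivative_pd[OF assms(2)]]]
  unfolding sum_axis_mult .

lemma pd_mult:
  assumes "f differentiable (at z)" "g differentiable (at z)"
  shows "pd k (\<lambda>z. f z * g z) z = f z * pd k g z + pd k f z * g z"
  using pd_has_derivative[OF has_derivative_mult[OF has_derivative_pd[OF assms(1)] has_derivative_pd[OF assms(2)]]]
  unfolding sum_axis_mult .

lemma pd_inverse:
  assumes "f differentiable (at z)" "f z \<noteq> 0"
  shows "pd k (\<lambda>z. inverse (f z)) z = - (inverse (f z) * pd k f z * inverse (f z))"
  using pd_has_derivative[OF Deriv.has_derivative_inverse[OF assms(2) has_derivative_pd[OF assms(1)]]]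
  unfolding sum_axis_mult .

context
  fixes S :: "(real^'k::finite) set"
  assumes S: "open S"
begin

lemma Ck_on_add: "Ck_on r S f \<Longrightarrow> Ck_on r S g \<Longrightarrow> Ck_on r S (\<lambda>z. f z + g z)"
proof (induction r arbitrary: f g)
  case 0
  then show ?case by (auto intro: continuous_intros)
next
  case (Suc r)
  then have "Ck_on r S (\<lambda>z. pd i f z + pd i g z)" for i by simp
  then have "Ck_on r S (pd i (\<lambda>z. f z + g z))" for i
    by (rule Ck_on_cong[OF S, rotated])
       (use Suc.prems in \<open>simp add: pd_add differentiable_at_open[OF _ S]\<close>)
  with Suc.prems show ?case by (simp add: differentiable_on_add)
qed

lemma Ck_on_mult: "Ck_on r S f \<Longrightarrow> Ck_on r S g \<Longrightarrow> Ck_on r S (\<lambda>z. f z * g z)"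
proof (induction r arbitrary: f g)
  case 0
  then show ?case by (auto intro: continuous_intros)
next
  case (Suc r)
  have "Ck_on r S (\<lambda>z. f z * pd i g z + pd i f z * g z)" for i
    using Suc.prems Ck_on_SucD[OF Suc.prems(1)] Ck_on_SucD[OF Suc.prems(2)] by (intro Ck_on_add Suc.IH) auto
  then have "Ck_on r S (pd i (\<lambda>z. f z * g z))" for i
    by (rule Ck_on_cong[OF S, rotated])
       (use Suc.prems in \<open>simp add: pd_mult differentiable_at_open[OF _ S]\<close>)
  with Suc.prems show ?case by (simp add: differentiable_on_mult)
qed

text \<open>The derivative of a reciprocal is a product containing the same reciprocal, which is
  needed only one order lower; the induction on the order therefore closes with \<open>f\<close>
  fixed.\<close>

lemma Ck_on_inverse:
  "(\<And>z. z \<in> S \<Longrightarrow> f z \<noteq> 0) \<Longrightarrow> Ck_on r S f \<Longrightarrow> Ck_on r S (\<lambda>z. inverse (f z))"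
proof (induction r)
  case 0
  then show ?case by (auto intro: continuous_intros)
next
  case (Suc r)
  then have i: "Ck_on r S (\<lambda>z. inverse (f z))" by (blast intro: Ck_on_SucD)
  have "Ck_on r S (\<lambda>z. (-1) * (inverse (f z) * pd i f z * inverse (f z)))" for i
    using Suc.prems by (intro Ck_on_mult Ck_on_const i) auto
  then have "Ck_on r S (pd i (\<lambda>z. inverse (f z)))" for i
    by (rule Ck_on_cong[OF S, rotated])
       (use Suc.prems in \<open>simp add: pd_inverse differentiable_at_open[OF _ S]\<close>)
  moreover have "(\<lambda>z. inverse (f z)) differentiable_on S"
    using Suc.prems by (auto simp: differentiable_on_def)
  ultimately show ?case by simp
qed

lemma smooth_on_cong: "smooth_on S f \<Longrightarrow> (\<And>w. w \<in> S \<Longrightarrow> f w = g w) \<Longrightarrow> smooth_on S g"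
  using Ck_on_cong[OF S] unfolding smooth_on_def by blast

lemma smooth_on_const: "smooth_on S (\<lambda>_. c)"
  by (simp add: smooth_on_def Ck_on_const)

lemma smooth_on_add: "smooth_on S f \<Longrightarrow> smooth_on S g \<Longrightarrow> smooth_on S (\<lambda>z. f z + g z)"
  by (simp add: smooth_on_def Ck_on_add)

lemma smooth_on_mult: "smooth_on S f \<Longrightarrow> smooth_on S g \<Longrightarrow> smooth_on S (\<lambda>z. f z * g z)"
  by (simp add: smooth_on_def Ck_on_mult)

lemma smooth_on_minus: "smooth_on S f \<Longrightarrow> smooth_on S (\<lambda>z. - f z)"
  using smooth_on_mult[OF smooth_on_const[of "-1"]] by simp

lemma smooth_on_diff: "smooth_on S f \<Longrightarrow> smooth_on S g \<Longrightarrow> smooth_on S (\<lambda>z. f z - g z)"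
  using smooth_on_add[OF _ smooth_on_minus, of f g] by simp

lemma smooth_on_divide:
  "smooth_on S f \<Longrightarrow> smooth_on S g \<Longrightarrow> (\<And>z. z \<in> S \<Longrightarrow> g z \<noteq> 0) \<Longrightarrow> smooth_on S (\<lambda>z. f z / g z)"
  unfolding divide_inverse
  by (intro smooth_on_mult) (auto simp: smooth_on_def intro: Ck_on_inverse)

lemma smooth_on_sum:
  "(\<And>i. i \<in> I \<Longrightarrow> smooth_on S (f i)) \<Longrightarrow> smooth_on S (\<lambda>z. \<Sum>i\<in>I. f i z)"
  by (induction I rule: infinite_finite_induct) (auto intro: smooth_on_const smooth_on_add)

lemma smooth_on_prod:
  "(\<And>i. i \<in> I \<Longrightarrow> smooth_on S (f i)) \<Longrightarrow> smooth_on S (\<lambda>z. \<Prod>i\<in>I. f i z)"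
  by (induction I rule: infinite_finite_induct) (auto intro: smooth_on_const smooth_on_mult)

lemma smooth_on_component: "smooth_on S (\<lambda>z. z $ k)"
  unfolding smooth_on_def
proof
  fix r
  have "pd i (\<lambda>z::real^'k. z $ k) = (\<lambda>_. axis i 1 $ k)" for i
    using pd_has_derivative[OF bounded_linear_imp_has_derivative[OF bounded_linear_vec_nth]] by blast
  then show "Ck_on r S (\<lambda>z. z $ k)"
    by (cases r) (auto intro: Ck_on_const continuous_intros linear_imp_differentiable_on
        bounded_linear.linear bounded_linear_vec_nth)
qed

lemma smooth_on_pd: "smooth_on S f \<Longrightarrow> smooth_on S (pd k f)"
  unfolding smooth_on_def by (metis Ck_on.simps(2))

lemma smooth_on_differentiable: "smooth_on S f \<Longrightarrow> z \<in> S \<Longrightarrow> f differentiable (at z)"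
  unfolding smooth_on_def by (metis Ck_on.simps(2) differentiable_at_open S)

lemma smooth_on_continuous: "smooth_on S f \<Longrightarrow> continuous_on S f"
  unfolding smooth_on_def by (metis Ck_on.simps(1))

text \<open>The second difference of \<open>f\<close> is symmetric in the two directions, and by the mean
  value theorem it is \<open>h\<^sup>2\<close> times the value of either mixed derivative at a nearby point.\<close>

lemma second_difference:
  assumes f: "smooth_on S f" and r: "ball z r \<subseteq> S" and h: "0 < h" "2 * h < r"
  obtains w where "dist z w \<le> 2 * h"
    "f (z + h *\<^sub>R axis i 1 + h *\<^sub>R axis j 1) - f (z + h *\<^sub>R axis i 1) - f (z + h *\<^sub>R axis j 1) + f z
       = h * (h * pd j (pd i f) w)"
proof -
  let ?a = "axis i (1::real) :: real^'k" and ?b = "axis j (1::real) :: real^'k"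
  have dist: "dist z (z + x *\<^sub>R ?a + y *\<^sub>R ?b) \<le> 2 * h" if "0 \<le> x" "x \<le> h" "0 \<le> y" "y \<le> h" for x y
    using that norm_triangle_ineq[of "x *\<^sub>R ?a" "y *\<^sub>R ?b"]
    by (subst dist_commute) (simp add: dist_norm add.assoc)
  have inS: "z + x *\<^sub>R ?a + y *\<^sub>R ?b \<in> S" if "0 \<le> x" "x \<le> h" "0 \<le> y" "y \<le> h" for x y
    using dist[OF that] r h by (auto simp: subset_iff)
  \<comment> \<open>The second difference is the increment over [0, h] of the difference in
    direction j, moved along direction i. One mean value step yields \<open>pd i f\<close>, a second
    one along j yields the mixed derivative.\<close>
  let ?\<phi> = "\<lambda>x. f (z + h *\<^sub>R ?b + x *\<^sub>R ?a) - f (z + x *\<^sub>R ?a)"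
  let ?\<phi>' = "\<lambda>x. pd i f (z + h *\<^sub>R ?b + x *\<^sub>R ?a) - pd i f (z + x *\<^sub>R ?a)"
  have "(?\<phi> has_real_derivative ?\<phi>' x) (at x)" if "0 \<le> x" "x \<le> h" for x
    using inS[of x h] inS[of x 0] that h f
    by (intro derivative_intros line_derivative smooth_on_differentiable) (auto simp: algebra_simps)
  from MVT2[OF h(1) this] obtain x where x: "0 < x" "x < h" "?\<phi> h - ?\<phi> 0 = h * ?\<phi>' x"
    by auto
  have "((\<lambda>y. pd i f (z + x *\<^sub>R ?a + y *\<^sub>R ?b)) has_real_derivative pd j (pd i f) (z + x *\<^sub>R ?a + y *\<^sub>R ?b)) (at y)"
    if "0 \<le> y" "y \<le> h" for y
    using inS[of x y] that x f
    by (intro line_derivative smooth_on_differentiable smooth_on_pd) auto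
  from MVT2[OF h(1) this] obtain y where y: "0 < y" "y < h"
    "pd i f (z + x *\<^sub>R ?a + h *\<^sub>R ?b) - pd i f (z + x *\<^sub>R ?a + 0 *\<^sub>R ?b) = h * pd j (pd i f) (z + x *\<^sub>R ?a + y *\<^sub>R ?b)"
    by auto
  have "?\<phi> h - ?\<phi> 0 = h * (h * pd j (pd i f) (z + x *\<^sub>R ?a + y *\<^sub>R ?b))"
    using x(3) y(3) by (simp add: add_ac)
  moreover have "dist z (z + x *\<^sub>R ?a + y *\<^sub>R ?b) \<le> 2 * h" using x y by (intro dist) auto
  ultimately show thesis by (intro that) (auto simp: add_ac)
qed

text \<open>Taking the two directions in either order represents one and the same second difference
  by each of the mixed derivatives, at two points near \<open>z\<close>. Continuity of both
  derivatives carries the equality to \<open>z\<close>.\<close>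

lemma pd_commute:
  assumes f: "smooth_on S f" and z: "z \<in> S"
  shows "pd i (pd j f) z = pd j (pd i f) z"
proof -
  let ?A = "pd i (pd j f)" and ?B = "pd j (pd i f)"
  have "dist (?A z) (?B z) < e" if "e > 0" for e
  proof -
    obtain r where r: "r > 0" "ball z r \<subseteq> S" using S z open_contains_ball by blast
    have "isCont ?A z" "isCont ?B z"
      using f z S smooth_on_continuous smooth_on_pd continuous_on_eq_continuous_at by blast+
    then obtain d1 d2 where d: "d1 > 0" "\<And>w. dist w z < d1 \<Longrightarrow> dist (?A w) (?A z) < e/2"
      "d2 > 0" "\<And>w. dist w z < d2 \<Longrightarrow> dist (?B w) (?B z) < e/2"
      using \<open>e > 0\<close> unfolding continuous_at_eps_delta dist_real_def by (metis half_gt_zero)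
    \<comment> \<open>The mean value points lie within 2 h of \<open>z\<close>; dividing by 3 keeps
      this strictly below all three radii.\<close>
    define h where "h = min r (min d1 d2) / 3"
    have h: "0 < h" "2 * h < r" "2 * h < d1" "2 * h < d2" using r d by (auto simp: h_def min_def)
    obtain w1 where w1: "dist z w1 \<le> 2 * h"
      "f (z + h *\<^sub>R axis i 1 + h *\<^sub>R axis j 1) - f (z + h *\<^sub>R axis i 1) - f (z + h *\<^sub>R axis j 1) + f z
         = h * (h * ?B w1)"
      using second_difference[OF f r(2) h(1,2)] .
    obtain w2 where w2: "dist z w2 \<le> 2 * h"
      "f (z + h *\<^sub>R axis j 1 + h *\<^sub>R axis i 1) - f (z + h *\<^sub>R axis j 1) - f (z + h *\<^sub>R axis i 1) + f z
         = h * (h * ?A w2)"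
      using second_difference[OF f r(2) h(1,2)] .
    have "h * (h * ?B w1) = h * (h * ?A w2)"
      unfolding w1(2)[symmetric] w2(2)[symmetric] by (simp add: algebra_simps)
    then have "?B w1 = ?A w2" using h by simp
    moreover have "dist (?A w2) (?A z) < e/2" "dist (?B w1) (?B z) < e/2"
      using d w1 w2 h by (auto simp: dist_commute)
    ultimately show ?thesis using dist_triangle_half_r by metis
  qed
  then show ?thesis by (metis dist_nz less_irrefl)
qed

lemma has_derivative_smooth:
  assumes "smooth_on S f" "z \<in> S"
  shows "(f has_derivative (\<lambda>v. \<Sum>k\<in>UNIV. v $ k * pd k f z)) (at z)"
  using assms by (intro has_derivative_pd smooth_on_differentiable)

end

section \<open>The Berwald connection\<close>

lemma smooth_on_det:
  fixes S :: "(real^'k::finite) set" and A :: "real^'k \<Rightarrow> real^'n::finite^'n"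
  assumes S: "open S" and A: "\<And>i j. smooth_on S (\<lambda>z. A z $ i $ j)"
  shows "smooth_on S (\<lambda>z. det (A z))"
  unfolding det_def
  by (intro smooth_on_sum smooth_on_mult smooth_on_const smooth_on_prod S A)

text \<open>Cramer's rule makes each entry of the inverse a quotient of two determinants, and these
  are polynomials in the entries of the matrix.\<close>

lemma smooth_on_matrix_inv:
  fixes S :: "(real^'k::finite) set" and A :: "real^'k \<Rightarrow> real^'n::finite^'n"
  assumes S: "open S" and A: "\<And>i j. smooth_on S (\<lambda>z. A z $ i $ j)"
    and inv: "\<And>z. z \<in> S \<Longrightarrow> invertible (A z)"
  shows "smooth_on S (\<lambda>z. matrix_inv (A z) $ i $ j)"
proof -
  \<comment> \<open>Column i is replaced by the j-th unit vector, so Cramer's quotient is coordinate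
    i of the solution v of A v = e_j, that is, of column j of the inverse.\<close>
  let ?C = "\<lambda>z. \<chi> k l. if l = i then axis j 1 $ k else A z $ k $ l"
  have "smooth_on S (\<lambda>z. ?C z $ k $ l)" for k l
    by (cases "l = i") (simp_all add: smooth_on_const S A)
  then have "smooth_on S (\<lambda>z. det (?C z) / det (A z))"
    using inv by (intro smooth_on_divide smooth_on_det S A) (auto simp: invertible_det_nz)
  moreover have "det (?C z) / det (A z) = matrix_inv (A z) $ i $ j" if "z \<in> S" for z
  proof -
    \<comment> \<open>\<open>matrix_inv\<close> is defined by choice; invertibility guarantees that
      the chosen matrix is an inverse.\<close>
    have "A z ** matrix_inv (A z) = mat 1"
      using inv[OF that] unfolding invertible_def matrix_inv_def by (rule someI2_ex) blast
    then have "A z *v (matrix_inv (A z) *v axis j 1) = axis j 1"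
      by (simp add: matrix_vector_mul_assoc)
    then have "(matrix_inv (A z) *v axis j 1) $ i = det (?C z) / det (A z)"
      using inv[OF that] by (subst (asm) cramer) (auto simp: invertible_det_nz)
    then show ?thesis by (simp add: matrix_vector_mul_component inner_axis matrix_vector_mult_basis column_def)
  qed
  ultimately show ?thesis by (rule smooth_on_cong[OF S])
qed

text \<open>The setting shared by source and target, interpreted once for each. Positive
  definiteness enters through the invertibility of the fundamental tensor.\<close>

locale regular_lagrangian =
  fixes S :: "(real^('p::finite + 'p)) set" and L :: "real^('p::finite + 'p) \<Rightarrow> real"
  assumes open_dom: "open S" and smooth: "smooth_on S L"
    and fund_invertible: "\<And>T. T \<in> S \<Longrightarrow> invertible (\<chi> \<alpha> \<beta>. fund L \<alpha> \<beta> T)"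
begin

lemma smooth_on_fund: "smooth_on S (fund L \<alpha> \<beta>)"
  unfolding fund_def power2_eq_square
  by (intro smooth_on_mult smooth_on_const smooth_on_pd smooth open_dom)

lemma smooth_on_fund_inv: "smooth_on S (fund_inv L \<mu> \<epsilon>)"
  unfolding fund_inv_def
  by (intro smooth_on_matrix_inv) (simp_all add: fund_invertible open_dom smooth_on_fund)

lemma smooth_on_christoffel: "smooth_on S (christoffel L \<mu> \<alpha> \<beta>)"
  unfolding christoffel_def
  by (intro smooth_on_sum smooth_on_mult smooth_on_divide smooth_on_const smooth_on_diff smooth_on_add
      smooth_on_pd smooth_on_fund smooth_on_fund_inv open_dom) simp

lemma smooth_on_spray: "smooth_on S (spray L \<mu>)"
  unfolding spray_def
  by (intro smooth_on_sum smooth_on_mult smooth_on_const smooth_on_component smooth_on_christoffel open_dom)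

lemma smooth_on_Nl: "smooth_on S (Nl L \<gamma> \<alpha>)"
  unfolding Nl_def by (intro smooth_on_pd smooth_on_spray open_dom)

lemma smooth_on_Bw: "smooth_on S (Bw L \<gamma> \<alpha> \<beta>)"
  unfolding Bw_def by (intro smooth_on_pd smooth_on_spray open_dom)

lemma smooth_on_Ncol: "smooth_on S (Ncol L c \<alpha> \<beta>)"
  unfolding Ncol_def
  by (intro smooth_on_diff smooth_on_add smooth_on_sum smooth_on_mult smooth_on_pd
      smooth_on_Nl smooth_on_Bw open_dom)

lemma Bw_sym: "T \<in> S \<Longrightarrow> Bw L \<gamma> \<alpha> \<beta> T = Bw L \<gamma> \<beta> \<alpha> T"
  unfolding Bw_def by (rule pd_commute[OF open_dom smooth_on_spray])

lemma pd_Nl: "pd (Inr \<beta>) (Nl L \<gamma> \<alpha>) = Bw L \<gamma> \<beta> \<alpha>"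
  by (simp add: Bw_def Nl_def)

lemma pd_Bw_sym: "T \<in> S \<Longrightarrow> pd k (Bw L \<gamma> \<alpha> \<beta>) T = pd k (Bw L \<gamma> \<beta> \<alpha>) T"
  by (rule pd_cong[OF open_dom]) (auto intro: Bw_sym)

lemma PB_sym_12: "T \<in> S \<Longrightarrow> PB L \<gamma> \<alpha> \<beta> \<epsilon> T = PB L \<gamma> \<beta> \<alpha> \<epsilon> T"
  unfolding PB_def by (rule pd_Bw_sym)

text \<open>\<open>PB\<close> is the third fibre derivative of the spray, and this is Schwarz's
  theorem for the outer two derivatives. Together with the exchange of the inner two it generates
  all permutations of the lower indices.\<close>

lemma PB_sym_13: "T \<in> S \<Longrightarrow> PB L \<gamma> \<alpha> \<beta> \<epsilon> T = PB L \<gamma> \<epsilon> \<beta> \<alpha> T"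
  unfolding PB_def Bw_def by (rule pd_commute[OF open_dom smooth_on_pd[OF open_dom smooth_on_spray]])

lemma PB_sym_23: "T \<in> S \<Longrightarrow> PB L \<gamma> \<alpha> \<beta> \<epsilon> T = PB L \<gamma> \<alpha> \<epsilon> \<beta> T"
  by (metis PB_sym_12 PB_sym_13)

text \<open>The product with the coefficient carrying both lower indices is symmetric and drops out.
  Since the fibre derivatives of \<open>Nl\<close> are \<open>Bw\<close>, the other products are
  exactly the fibre parts of the horizontal derivatives in \<open>RN\<close>.\<close>

lemma Ncol_antisym:
  assumes "T \<in> S"
  shows "Ncol L a \<beta> \<gamma> T - Ncol L a \<gamma> \<beta> T = RN L a \<beta> \<gamma> T"
  by (simp add: Ncol_def RN_def delta_t_def pd_Nl Bw_sym[OF assms, of _ \<gamma> \<beta>])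

end

section \<open>Smooth vector fields and connections on open sets\<close>

lemma smooth_vfield_coord_field: "open S \<Longrightarrow> smooth_vfield S (coord_field k)"
  by (simp add: smooth_vfield_def coord_field_def smooth_on_const)

lemma smooth_vfield_sum:
  "open S \<Longrightarrow> (\<And>i. i \<in> I \<Longrightarrow> smooth_vfield S (X i)) \<Longrightarrow> smooth_vfield S (\<lambda>w. \<Sum>i\<in>I. X i w)"
  by (simp add: smooth_vfield_def smooth_on_sum)

lemma smooth_vfield_scaleR:
  "open S \<Longrightarrow> smooth_on S f \<Longrightarrow> smooth_vfield S X \<Longrightarrow> smooth_vfield S (\<lambda>w. f w *\<^sub>R X w)"
  by (simp add: smooth_vfield_def smooth_on_mult)

lemma smooth_vfield_diff:
  "open S \<Longrightarrow> smooth_vfield S X \<Longrightarrow> smooth_vfield S Y \<Longrightarrow> smooth_vfield S (\<lambda>w. X w - Y w)"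
  by (simp add: smooth_vfield_def smooth_on_diff)

lemma coord_field_nth: "coord_field k T $ l = (if l = k then 1 else 0)"
  by (simp add: coord_field_def axis_def)

lemma vf_apply_coord_field: "vf_apply (coord_field k) f z = pd k f z"
  by (simp add: vf_apply_def coord_field_def axis_def if_distrib[of "\<lambda>x. x * _"] cong: if_cong)

locale smooth_connection =
  fixes S :: "(real^'k::finite) set" and D :: "'k vfield \<Rightarrow> 'k vfield \<Rightarrow> 'k vfield"
  assumes open_set: "open S" and linear_connection: "linear_connection S D"
begin

lemma D_add_left:
  "smooth_vfield S X \<Longrightarrow> smooth_vfield S X' \<Longrightarrow> smooth_vfield S Y \<Longrightarrow> z \<in> S \<Longrightarrow>
    D (\<lambda>w. X w + X' w) Y z = D X Y z + D X' Y z"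
  using linear_connection unfolding linear_connection_def by blast

lemma D_add_right:
  "smooth_vfield S X \<Longrightarrow> smooth_vfield S Y \<Longrightarrow> smooth_vfield S Y' \<Longrightarrow> z \<in> S \<Longrightarrow>
    D X (\<lambda>w. Y w + Y' w) z = D X Y z + D X Y' z"
  using linear_connection unfolding linear_connection_def by blast

lemma D_scale_left:
  "smooth_on S f \<Longrightarrow> smooth_vfield S X \<Longrightarrow> smooth_vfield S Y \<Longrightarrow> z \<in> S \<Longrightarrow>
    D (\<lambda>w. f w *\<^sub>R X w) Y z = f z *\<^sub>R D X Y z"
  using linear_connection unfolding linear_connection_def by blast

lemma D_scale_right:
  "smooth_on S f \<Longrightarrow> smooth_vfield S X \<Longrightarrow> smooth_vfield S Y \<Longrightarrow> z \<in> S \<Longrightarrow>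
    D X (\<lambda>w. f w *\<^sub>R Y w) z = vf_apply X f z *\<^sub>R Y z + f z *\<^sub>R D X Y z"
  using linear_connection unfolding linear_connection_def by blast

lemma D_sum_left:
  assumes "finite I" "\<And>i. i \<in> I \<Longrightarrow> smooth_vfield S (X i)" "smooth_vfield S Y" "z \<in> S"
  shows "D (\<lambda>w. \<Sum>i\<in>I. X i w) Y z = (\<Sum>i\<in>I. D (X i) Y z)"
  using assms(1,2)
proof (induction I)
  case empty
  \<comment> \<open>The zero field is read as the constant function 0 times the smooth field
    \<open>Y\<close>.\<close>
  show ?case using D_scale_left[OF smooth_on_const[OF open_set, of 0] assms(3,3,4)] by simp
next
  case (insert i I)
  then show ?case
    using assms(3,4) by (simp add: D_add_left smooth_vfield_sum open_set)
qed

lemma D_sum_right: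
  assumes "finite I" "\<And>i. i \<in> I \<Longrightarrow> smooth_vfield S (Y i)" "smooth_vfield S X" "z \<in> S"
  shows "D X (\<lambda>w. \<Sum>i\<in>I. Y i w) z = (\<Sum>i\<in>I. D X (Y i) z)"
  using assms(1,2)
proof (induction I)
  case empty
  have "vf_apply X (\<lambda>_. 0) z = 0" by (simp add: vf_apply_def pd_def)
  then show ?case using D_scale_right[OF smooth_on_const[OF open_set, of 0] assms(3,3,4)] by simp
next
  case (insert i I)
  then show ?case
    using assms(3,4) by (simp add: D_add_right smooth_vfield_sum open_set)
qed

end

section \<open>Coordinate coefficients of the Berwald connection\<close>

locale berwald = regular_lagrangian S L
  for S :: "(real^('p::finite + 'p)) set" and L :: "real^('p::finite + 'p) \<Rightarrow> real" +
  fixes nabla :: "('p + 'p) vfield \<Rightarrow> ('p + 'p) vfield \<Rightarrow> ('p + 'p) vfield"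
  assumes berwald_connection: "berwald_connection S L nabla"

sublocale berwald \<subseteq> smooth_connection S nabla
  using open_dom berwald_connection by unfold_locales (auto simp: berwald_connection_def)

context berwald
begin

lemma coord_field_Inl:
  "coord_field (Inl \<alpha>) = (\<lambda>w. delta_field L \<alpha> w + (\<Sum>\<epsilon>\<in>UNIV. Nl L \<epsilon> \<alpha> w *\<^sub>R coord_field (Inr \<epsilon>) w))"
  by (simp add: delta_field_def fun_eq_iff)

lemma smooth_vfield_delta: "smooth_vfield S (delta_field L \<alpha>)"
  unfolding delta_field_def
  by (intro smooth_vfield_diff smooth_vfield_sum smooth_vfield_scaleR smooth_vfield_coord_field
      smooth_on_Nl open_dom)

lemma smooth_vfield_vertical: "smooth_vfield S (\<lambda>w. \<Sum>\<epsilon>\<in>UNIV. Nl L \<epsilon> \<alpha> w *\<^sub>R coord_field (Inr \<epsilon>) w)"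
  by (intro smooth_vfield_sum smooth_vfield_scaleR smooth_vfield_coord_field smooth_on_Nl open_dom)

lemma nabla_Inl_left:
  assumes "smooth_vfield S Y" "T \<in> S"
  shows "nabla (coord_field (Inl \<beta>)) Y T =
    nabla (delta_field L \<beta>) Y T + (\<Sum>\<epsilon>\<in>UNIV. Nl L \<epsilon> \<beta> T *\<^sub>R nabla (coord_field (Inr \<epsilon>)) Y T)"
  by (subst coord_field_Inl)
     (simp add: D_add_left D_sum_left D_scale_left smooth_vfield_delta smooth_vfield_vertical
        smooth_vfield_scaleR smooth_vfield_coord_field smooth_on_Nl open_dom assms)

text \<open>In the differentiated slot the coefficients \<open>Nl\<close> are themselves
  differentiated. This is the origin of the base derivative of \<open>Nl\<close> in
  \<open>Ncol\<close>, and of the nonzero covariant derivative of a base coordinate field in a fibre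
  direction.\<close>

lemma nabla_Inl_right:
  assumes "smooth_vfield S X" "T \<in> S"
  shows "nabla X (coord_field (Inl \<alpha>)) T =
    nabla X (delta_field L \<alpha>) T + (\<Sum>\<epsilon>\<in>UNIV. vf_apply X (Nl L \<epsilon> \<alpha>) T *\<^sub>R coord_field (Inr \<epsilon>) T
      + Nl L \<epsilon> \<alpha> T *\<^sub>R nabla X (coord_field (Inr \<epsilon>)) T)"
  by (subst coord_field_Inl)
     (simp add: D_add_right D_sum_right D_scale_right smooth_vfield_delta smooth_vfield_vertical
        smooth_vfield_scaleR smooth_vfield_coord_field smooth_on_Nl open_dom assms)

lemmas coord_smooth = smooth_vfield_coord_field[OF open_dom]

lemma nabla_adapted:
  assumes "T \<in> S"
  shows "nabla (delta_field L \<beta>) (delta_field L \<alpha>) T = (\<Sum>\<gamma>\<in>UNIV. Bw L \<gamma> \<alpha> \<beta> T *\<^sub>R delta_field L \<gamma> T)"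
    "nabla (delta_field L \<beta>) (coord_field (Inr a)) T = (\<Sum>c\<in>UNIV. Bw L c a \<beta> T *\<^sub>R coord_field (Inr c) T)"
    "nabla (coord_field (Inr b)) (delta_field L \<alpha>) T = 0"
    "nabla (coord_field (Inr b)) (coord_field (Inr a)) T = 0"
  using berwald_connection assms unfolding berwald_connection_def by blast+

lemma nabla_coord:
  assumes "T \<in> S"
  shows "nabla (coord_field (Inl \<beta>)) (coord_field (Inr a)) T = (\<Sum>c\<in>UNIV. Bw L c a \<beta> T *\<^sub>R coord_field (Inr c) T)"
    "nabla (coord_field (Inr b)) (coord_field (Inr a)) T = 0"
    "nabla (coord_field (Inr b)) (coord_field (Inl \<alpha>)) T = (\<Sum>c\<in>UNIV. Bw L c b \<alpha> T *\<^sub>R coord_field (Inr c) T)"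
    "nabla (coord_field (Inl \<beta>)) (coord_field (Inl \<alpha>)) T =
      (\<Sum>\<gamma>\<in>UNIV. Bw L \<gamma> \<alpha> \<beta> T *\<^sub>R delta_field L \<gamma> T) +
      (\<Sum>\<epsilon>\<in>UNIV. pd (Inl \<beta>) (Nl L \<epsilon> \<alpha>) T *\<^sub>R coord_field (Inr \<epsilon>) T +
         Nl L \<epsilon> \<alpha> T *\<^sub>R (\<Sum>c\<in>UNIV. Bw L c \<epsilon> \<beta> T *\<^sub>R coord_field (Inr c) T))"
  using assms
  by (simp_all add: nabla_Inl_left nabla_Inl_right coord_smooth smooth_vfield_delta
      nabla_adapted vf_apply_coord_field pd_Nl)

lemma delta_field_nth:
  "delta_field L \<gamma> T $ Inl \<alpha> = (if \<alpha> = \<gamma> then 1 else 0)"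
  "delta_field L \<gamma> T $ Inr c = - Nl L c \<gamma> T"
  by (simp_all add: delta_field_def coord_field_nth mult_delta_right)

text \<open>The subtracted product in \<open>Ncol\<close> comes from reading the horizontal fields
  on the right of \<open>nabla_coord\<close> in coordinates, where their fibre components are minus
  \<open>Nl\<close>.\<close>

lemma conn_coeff_nonzero:
  assumes "T \<in> S"
  shows "conn_coeff nabla (Inl \<gamma>) (Inl \<alpha>) (Inl \<beta>) T = Bw L \<gamma> \<alpha> \<beta> T"
    "conn_coeff nabla (Inr c) (Inl \<alpha>) (Inl \<beta>) T = Ncol L c \<alpha> \<beta> T"
    "conn_coeff nabla (Inr c) (Inr a) (Inl \<beta>) T = Bw L c a \<beta> T"
    "conn_coeff nabla (Inr c) (Inl \<alpha>) (Inr b) T = Bw L c \<alpha> b T"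
  by (simp_all add: conn_coeff_def nabla_coord[OF assms] coord_field_nth delta_field_nth
      mult_delta_left mult_delta_right sum.distrib sum_negf Ncol_def mult.commute[of "Bw L _ _ _ _"]
      Bw_sym[OF assms, of _ \<alpha> b])

lemma conn_coeff_zero:
  assumes "T \<in> S"
  shows "conn_coeff nabla (Inl \<gamma>) (Inr a) B T = 0" "conn_coeff nabla (Inl \<gamma>) A (Inr b) T = 0"
    "conn_coeff nabla C (Inr a) (Inr b) T = 0"
proof -
  show "conn_coeff nabla (Inl \<gamma>) (Inr a) B T = 0"
    by (cases B) (simp_all add: conn_coeff_def nabla_coord[OF assms] coord_field_nth)
  show "conn_coeff nabla (Inl \<gamma>) A (Inr b) T = 0"
    by (cases A) (simp_all add: conn_coeff_def nabla_coord[OF assms] coord_field_nth)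
qed (simp add: conn_coeff_def nabla_coord[OF assms])

lemma smooth_on_conn_coeff: "smooth_on S (conn_coeff nabla C A B)"
proof -
  have cong: "smooth_on S g" if "smooth_on S f" "\<And>w. w \<in> S \<Longrightarrow> g w = f w" for f g
    using smooth_on_cong[OF open_dom that(1)] that(2) by metis
  show ?thesis
    by (cases C; cases A; cases B; simp)
       (rule cong[OF smooth_on_Bw] cong[OF smooth_on_Ncol] cong[OF smooth_on_const[OF open_dom, of 0]];
        simp add: conn_coeff_nonzero conn_coeff_zero; fail)+
qed

text \<open>The preceding formulas hold at every point of the open set \<open>S\<close>, so partial
  derivatives of both sides agree.\<close>

lemma pd_conn_coeff:
  assumes "T \<in> S"
  shows "pd k (conn_coeff nabla (Inl \<gamma>) (Inl \<alpha>) (Inl \<beta>)) T = pd k (Bw L \<gamma> \<alpha> \<beta>) T"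
    "pd k (conn_coeff nabla (Inr c) (Inl \<alpha>) (Inl \<beta>)) T = pd k (Ncol L c \<alpha> \<beta>) T"
    "pd k (conn_coeff nabla (Inr c) (Inr a) (Inl \<beta>)) T = pd k (Bw L c a \<beta>) T"
    "pd k (conn_coeff nabla (Inr c) (Inl \<alpha>) (Inr b)) T = pd k (Bw L c \<alpha> b) T"
    "pd k (conn_coeff nabla (Inl \<gamma>) (Inr a) B) T = 0"
    "pd k (conn_coeff nabla (Inl \<gamma>) A (Inr b)) T = 0"
    "pd k (conn_coeff nabla C (Inr a) (Inr b)) T = 0"
proof -
  have 0: "pd k f T = 0" if "\<And>w. w \<in> S \<Longrightarrow> f w = 0" for f
  proof -
    have "pd k f T = pd k (\<lambda>_. 0) T" by (rule pd_cong[OF open_dom assms that])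
    then show ?thesis by (simp add: pd_def)
  qed
  show "pd k (conn_coeff nabla (Inl \<gamma>) (Inr a) B) T = 0"
    "pd k (conn_coeff nabla (Inl \<gamma>) A (Inr b)) T = 0"
    "pd k (conn_coeff nabla C (Inr a) (Inr b)) T = 0"
    by (rule 0, simp add: conn_coeff_zero)+
qed (rule pd_cong[OF open_dom assms], simp add: conn_coeff_nonzero)+

end

section \<open>Torsion in an adapted frame\<close>

lemma sum_UNIV_Plus: "(\<Sum>x\<in>UNIV. f x) = (\<Sum>a\<in>UNIV. f (Inl a)) + (\<Sum>b\<in>UNIV. f (Inr b))"
  for f :: "'a::finite + 'b::finite \<Rightarrow> 'c::comm_monoid_add"
  by (simp add: UNIV_Plus_UNIV[symmetric] sum.Plus del: UNIV_Plus_UNIV)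

lemma sum_UNIV_prod: "(\<Sum>x\<in>UNIV. f x) = (\<Sum>a\<in>UNIV. \<Sum>b\<in>UNIV. f (a, b))"
  for f :: "'a::finite \<times> 'b::finite \<Rightarrow> 'c::comm_monoid_add"
  by (simp add: sum.cartesian_product UNIV_Times_UNIV)

text \<open>Independence makes an exhibited expansion the only one, which is what the definite
  description asks for.\<close>

lemma basis_comp_eqI:
  assumes v: "v = (\<Sum>k\<in>UNIV. c k *\<^sub>R e k)"
    and indep: "\<And>c. (\<Sum>k\<in>UNIV. c k *\<^sub>R e k) = 0 \<Longrightarrow> (\<And>k. c k = 0)"
  shows "basis_comp e v $ k = c k"
proof -
  have "basis_comp e v = (\<chi> k. c k)"
    unfolding basis_comp_def
  proof (rule the_equality)
    fix c' assume c': "v = (\<Sum>k\<in>UNIV. (c' $ k) *\<^sub>R e k)"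
    have "(\<Sum>k\<in>UNIV. (c' $ k - c k) *\<^sub>R e k) = 0"
      using v c' by (simp add: scaleR_diff_left sum_subtractf)
    then show "c' = (\<chi> k. c k)" using indep by (simp add: vec_eq_iff) (metis eq_iff_diff_eq_0)
  qed (simp add: v)
  then show ?thesis by simp
qed

text \<open>One array for both parts of the nonlinear connection, extended by 0 to vertical indices.
  Every frame field is then its coordinate field minus a vertical field with these components, so
  that one formula covers all brackets.\<close>

definition frame_coeff ::
  "('p + 'p \<Rightarrow> 'p + 'p \<Rightarrow> 'p + 'p \<Rightarrow> real^('p + 'p) \<Rightarrow> real) \<Rightarrow> (real^('n + 'n) \<Rightarrow> real) \<Rightarrow>
     ('p::finite, 'n::finite) jidx \<Rightarrow> 'p + 'p \<Rightarrow> 'n \<Rightarrow> ('p, 'n) jet \<Rightarrow> real" where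
  "frame_coeff \<Gamma> L' K M m =
     (case K of Inl A \<Rightarrow> jetM \<Gamma> m M A | Inr (Inl i) \<Rightarrow> jetN L' m M i | Inr (Inr _) \<Rightarrow> (\<lambda>_. 0))"

lemma frame_coeff_simps [simp]:
  "frame_coeff \<Gamma> L' (iT A) M m = jetM \<Gamma> m M A"
  "frame_coeff \<Gamma> L' (ix i) M m = jetN L' m M i"
  "frame_coeff \<Gamma> L' (Inr (Inr q)) M m = (\<lambda>_. 0)"
  by (simp_all add: frame_coeff_def)

lemma adapted_basis_simps [simp]:
  "adapted_basis \<Gamma> L' (iT A) = adapted_T \<Gamma> A"
  "adapted_basis \<Gamma> L' (ix i) = adapted_x L' i"
  "adapted_basis \<Gamma> L' (iX A i) = adapted_X A i"
  by (simp_all add: adapted_basis_def)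

lemma sum_iX_nth:
  "(\<Sum>B\<in>UNIV. \<Sum>j\<in>UNIV. f B j *\<^sub>R coord_field (iX B j) z) $ Inl A = 0"
  "(\<Sum>B\<in>UNIV. \<Sum>j\<in>UNIV. f B j *\<^sub>R coord_field (iX B j) z) $ ix i = 0"
  "(\<Sum>B\<in>UNIV. \<Sum>j\<in>UNIV. f B j *\<^sub>R coord_field (iX B j) z) $ iX M m = f M m"
proof -
  have "(\<Sum>B\<in>UNIV. \<Sum>j\<in>UNIV. if M = B \<and> m = j then f B j else 0) =
     (\<Sum>B\<in>UNIV. if B = M then (\<Sum>j\<in>UNIV. if j = m then f B j else 0) else 0)"
    by (intro sum.cong refl) (auto intro!: sum.cong)
  then show "(\<Sum>B\<in>UNIV. \<Sum>j\<in>UNIV. f B j *\<^sub>R coord_field (iX B j) z) $ iX M m = f M m"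
    by (simp add: coord_field_nth mult_delta_right cong: if_cong)
qed (simp_all add: coord_field_nth)

lemma adapted_basis_nth:
  "adapted_basis \<Gamma> L' K z $ Inl A = (if K = Inl A then 1 else 0)"
  "adapted_basis \<Gamma> L' K z $ ix i = (if K = ix i then 1 else 0)"
  "adapted_basis \<Gamma> L' K z $ iX M m = (if K = iX M m then 1 else 0) - frame_coeff \<Gamma> L' K M m z"
proof -
  consider (T) B where "K = iT B" | (x) j where "K = ix j" | (X) B j where "K = iX B j"
    by (metis sumE surj_pair)
  then have "adapted_basis \<Gamma> L' K z $ Inl A = (if K = Inl A then 1 else 0) \<and>
    adapted_basis \<Gamma> L' K z $ ix i = (if K = ix i then 1 else 0) \<and>
    adapted_basis \<Gamma> L' K z $ iX M m = (if K = iX M m then 1 else 0) - frame_coeff \<Gamma> L' K M m z"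
    by cases (auto simp: adapted_T_def adapted_x_def adapted_X_def sum_iX_nth coord_field_nth
        simp del: sum_component)
  then show "adapted_basis \<Gamma> L' K z $ Inl A = (if K = Inl A then 1 else 0)"
    "adapted_basis \<Gamma> L' K z $ ix i = (if K = ix i then 1 else 0)"
    "adapted_basis \<Gamma> L' K z $ iX M m = (if K = iX M m then 1 else 0) - frame_coeff \<Gamma> L' K M m z"
    by blast+
qed

text \<open>The frame is unitriangular over the coordinate fields: the T and x components isolate
  the coefficients of the first two kinds of fields, and once these vanish the X components isolate
  the rest.\<close>

lemma adapted_basis_indep:
  assumes "(\<Sum>K\<in>UNIV. c K *\<^sub>R adapted_basis \<Gamma> L' K z) = 0"
  shows "c K = 0"
proof -
  have comp: "(\<Sum>K\<in>UNIV. c K * adapted_basis \<Gamma> L' K z $ I) = 0" for I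
    using arg_cong[OF assms, of "\<lambda>v. v $ I"] by simp
  have T: "c (iT A) = 0" for A
    using comp[of "iT A"] by (simp add: adapted_basis_nth mult_delta_right)
  have x: "c (ix i) = 0" for i
    using comp[of "ix i"] by (simp add: adapted_basis_nth mult_delta_right)
  have X: "c (iX M m) = 0" for M m
  proof -
    have "(\<Sum>K\<in>UNIV. c K * frame_coeff \<Gamma> L' K M m z) = 0"
      using T x by (intro sum.neutral) (auto simp: frame_coeff_def split: sum.split)
    then show ?thesis
      using comp[of "iX M m"] by (simp add: adapted_basis_nth right_diff_distrib mult_delta_right sum_subtractf cong: if_cong)
  qed
  show ?thesis using T x X by (metis sumE surj_pair)
qed

text \<open>The coefficients of \<open>D\<close> in the adapted frame as one array, with arguments
  in the order direction, differentiated field, component. The last clause covers vertical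
  directions and all changes of type.\<close>

fun frame_conn ::
  "('p + 'p \<Rightarrow> 'p + 'p \<Rightarrow> 'p + 'p \<Rightarrow> real^('p + 'p) \<Rightarrow> real) \<Rightarrow> (real^('n + 'n) \<Rightarrow> real) \<Rightarrow>
     ('p::finite, 'n::finite) jet \<Rightarrow> ('p, 'n) jidx \<Rightarrow> ('p, 'n) jidx \<Rightarrow> ('p, 'n) jidx \<Rightarrow> real" where
  "frame_conn \<Gamma> L' z (Inl C) (Inl B) (Inl A) = \<Gamma> A B C (jet_source z)"
| "frame_conn \<Gamma> L' z (Inl C) (Inr (Inr (B, j))) (Inr (Inr (A, i))) =
     - (if i = j then 1 else 0) * \<Gamma> B C A (jet_source z)"
| "frame_conn \<Gamma> L' z (Inr (Inl j)) (Inr (Inl i)) (Inr (Inl k)) = Bw L' k i j (jet_target z)"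
| "frame_conn \<Gamma> L' z (Inr (Inl k)) (Inr (Inr (B, j))) (Inr (Inr (A, i))) =
     (if B = A then 1 else 0) * Bw L' i j k (jet_target z)"
| "frame_conn \<Gamma> L' z _ _ _ = 0"

lemma D_frame:
  assumes "jet_berwald_connection J \<Gamma> L' D" "z \<in> J"
  shows "D (adapted_basis \<Gamma> L' H) (adapted_basis \<Gamma> L' K) z =
    (\<Sum>U\<in>UNIV. frame_conn \<Gamma> L' z H K U *\<^sub>R adapted_basis \<Gamma> L' U z)"
proof -
  \<comment> \<open>The definition of the jet connection sums over i outermost, whereas the sum over
    the pair index (A, i) has A outermost.\<close>
  have sums: "(\<Sum>i\<in>UNIV. \<Sum>A\<in>UNIV. f A i) = (\<Sum>A\<in>UNIV. \<Sum>i\<in>UNIV. f A i)"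
    for f :: "'a + 'a \<Rightarrow> 'b \<Rightarrow> real^('a, 'b) jidx"
    by (rule sum.swap)
  consider (TT) C B where "H = iT C" "K = iT B" | (Tx) C i where "H = iT C" "K = ix i"
    | (TX) C B j where "H = iT C" "K = iX B j" | (xT) j B where "H = ix j" "K = iT B"
    | (xx) j i where "H = ix j" "K = ix i" | (xX) k B j where "H = ix k" "K = iX B j"
    | (X) C k where "H = iX C k"
    by (metis sumE surj_pair)
  then show ?thesis
  proof cases
    case X
    then show ?thesis using assms by (simp add: jet_berwald_connection_def)
  qed (use assms in \<open>simp_all add: jet_berwald_connection_def sum_UNIV_Plus[where 'b = "'b + ('a + 'a) \<times> 'b"]
      sum_UNIV_Plus[where 'b = "('a + 'a) \<times> 'b"] sum_UNIV_prod sums\<close>)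
qed

text \<open>Fits the vertical components of the frame fields, each a Kronecker constant minus a
  coefficient.\<close>

lemma vf_apply_const_minus:
  assumes "f differentiable (at z)"
  shows "vf_apply X (\<lambda>w. c - f w) z = - vf_apply X f z"
proof -
  obtain f' where f: "(f has_derivative f') (at z)" using assms by (auto simp: differentiable_def)
  from has_derivative_diff[OF has_derivative_const this]
  have "((\<lambda>w. c - f w) has_derivative (\<lambda>v. 0 - f' v)) (at z)" .
  from vf_apply_has_derivative[OF this] vf_apply_has_derivative[OF f] show ?thesis by simp
qed

lemma vf_apply_const: "vf_apply X (\<lambda>_. c) z = 0"
  by (simp add: vf_apply_def pd_def)

text \<open>Coefficients enter the frame with a minus sign and the bracket enters the torsion with a
  minus sign; the two cancel, so the derivative along \<open>H\<close> of the coefficient of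
  \<open>K\<close> appears positively.\<close>

lemma d_torsion_eq:
  assumes D: "jet_berwald_connection J \<Gamma> L' D" "z \<in> J"
    and diff: "\<And>K M m. frame_coeff \<Gamma> L' K M m differentiable (at z)"
  shows "d_torsion \<Gamma> L' D U K H z = frame_conn \<Gamma> L' z H K U - frame_conn \<Gamma> L' z K H U +
    (case U of Inr (Inr (M, m)) \<Rightarrow>
       vf_apply (adapted_basis \<Gamma> L' H) (frame_coeff \<Gamma> L' K M m) z -
       vf_apply (adapted_basis \<Gamma> L' K) (frame_coeff \<Gamma> L' H M m) z
     | _ \<Rightarrow> 0)" (is "_ = ?c U")
  unfolding d_torsion_def
proof (rule basis_comp_eqI[of _ ?c])
  let ?E = "adapted_basis \<Gamma> L'"
  let ?b = "\<lambda>M m. vf_apply (?E H) (frame_coeff \<Gamma> L' K M m) z - vf_apply (?E K) (frame_coeff \<Gamma> L' H M m) z"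
  have "- lie_bracket (?E H) (?E K) z = (\<Sum>M\<in>UNIV. \<Sum>m\<in>UNIV. ?b M m *\<^sub>R coord_field (iX M m) z)"
    (is "_ = ?R")
  proof (rule vec_eq_iff[THEN iffD2], rule allI)
    fix I :: "('a, 'b) jidx"
    consider (T) B where "I = iT B" | (x) j where "I = ix j" | (X) B j where "I = iX B j"
      by (metis sumE surj_pair)
    then show "(- lie_bracket (?E H) (?E K) z) $ I = ?R $ I"
      by cases (simp_all add: lie_bracket_def adapted_basis_nth vf_apply_const
          vf_apply_const_minus diff sum_iX_nth del: sum_component)
  qed
  \<comment> \<open>The vertical coordinate fields belong to the frame, so this is already an
    expansion in the frame.\<close>
  also have "\<dots> = (\<Sum>U\<in>UNIV. (case U of Inr (Inr (M, m)) \<Rightarrow> ?b M m | _ \<Rightarrow> 0) *\<^sub>R ?E U z)"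
    by (simp add: sum_UNIV_Plus[where 'b = "'b + ('a + 'a) \<times> 'b"]
      sum_UNIV_Plus[where 'b = "('a + 'a) \<times> 'b"] sum_UNIV_prod adapted_X_def)
  finally show "torsion D (?E H) (?E K) z = (\<Sum>U\<in>UNIV. ?c U *\<^sub>R ?E U z)"
    unfolding torsion_def
    by (simp add: D_frame[OF D] scaleR_add_left scaleR_diff_left sum.distrib sum_subtractf sum_negf diff_conv_add_uminus
        del: sum_component add_uminus_conv_diff)
qed (rule adapted_basis_indep)

section \<open>Torsion of the jet Berwald connection\<close>

lemma has_derivative_vecI:
  fixes f :: "'a::real_normed_vector \<Rightarrow> real^'k::finite"
  assumes "\<And>k. ((\<lambda>x. f x $ k) has_derivative (\<lambda>v. f' v $ k)) (at z)"
  shows "(f has_derivative f') (at z)"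
  using assms
  by (subst has_derivative_componentwise_within) (auto simp: Basis_vec_def inner_axis)

lemma jet_source_has_derivative: "(jet_source has_derivative jet_source) (at z)"
  by (rule has_derivative_vecI)
     (auto simp: jet_source_def intro!: bounded_linear_imp_has_derivative bounded_linear_vec_nth)

text \<open>The fibre part is bilinear in y and s. Varying s leaves the factor y seen in
  \<open>torsion_T11_T13\<close>; varying y leaves the factor s seen in
  \<open>torsion_T2_T3\<close>.\<close>

lemma jet_target_has_derivative:
  "(jet_target has_derivative (\<lambda>v. \<chi> k. case k of Inl l \<Rightarrow> v $ ix l
      | Inr l \<Rightarrow> (\<Sum>a\<in>UNIV. y_jet z l a * s_coord v a + y_jet v l a * s_coord z a))) (at z)"
proof (rule has_derivative_vecI)
  note [derivative_intros] = bounded_linear.has_derivative[OF bounded_linear_vec_nth]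
  show "((\<lambda>x. jet_target x $ k) has_derivative (\<lambda>v. (\<chi> k. case k of Inl l \<Rightarrow> v $ ix l
      | Inr l \<Rightarrow> (\<Sum>a\<in>UNIV. y_jet z l a * s_coord v a + y_jet v l a * s_coord z a)) $ k)) (at z)" for k
    by (cases k) (auto simp: jet_target_def intro!: derivative_eq_intros)
qed

locale jet_berwald = src: berwald S L nabla + tgt: regular_lagrangian S' L'
  for S :: "(real^('p::finite + 'p)) set" and L :: "real^('p + 'p) \<Rightarrow> real"
    and nabla :: "('p + 'p) vfield \<Rightarrow> ('p + 'p) vfield \<Rightarrow> ('p + 'p) vfield"
    and S' :: "(real^('n::finite + 'n)) set" and L' :: "real^('n + 'n) \<Rightarrow> real" +
  fixes J :: "('p, 'n) jet set"
    and D :: "('p, 'n) jidx vfield \<Rightarrow> ('p, 'n) jidx vfield \<Rightarrow> ('p, 'n) jidx vfield"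
    and z :: "('p, 'n) jet"
  assumes jet_berwald_connection: "jet_berwald_connection J (conn_coeff nabla) L' D"
    and z_in: "z \<in> J" and source_in: "jet_source z \<in> S" and target_in: "jet_target z \<in> S'"
begin

abbreviation \<Gamma> where "\<Gamma> \<equiv> conn_coeff nabla"
abbreviation T where "T \<equiv> jet_source z"
abbreviation w where "w \<equiv> jet_target z"
abbreviation \<tau> where "\<tau> \<equiv> d_torsion \<Gamma> L' D"

lemma jetM_has_derivative:
  "(jetM \<Gamma> m M A has_derivative (\<lambda>v. - (\<Sum>C\<in>UNIV.
     \<Gamma> C A M T * v $ iX C m + (\<Sum>E\<in>UNIV. v $ iT E * pd E (\<Gamma> C A M) T) * z $ iX C m))) (at z)"
proof -
  note [derivative_intros] = bounded_linear.has_derivative[OF bounded_linear_vec_nth]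
  have "((\<lambda>z. \<Gamma> C A M (jet_source z)) has_derivative (\<lambda>v. \<Sum>E\<in>UNIV. v $ iT E * pd E (\<Gamma> C A M) T)) (at z)" for C
    using has_derivative_compose[OF jet_source_has_derivative
        has_derivative_smooth[OF src.open_dom src.smooth_on_conn_coeff source_in]]
    by (simp add: jet_source_def)
  note [derivative_intros] = this
  show ?thesis
    unfolding jetM_def
    by (auto intro!: derivative_eq_intros)
qed

lemma jetN_has_derivative:
  "(jetN L' m M i has_derivative (\<lambda>v. \<Sum>k\<in>UNIV. Bw L' m i k w * v $ iX M k +
     ((\<Sum>l\<in>UNIV. v $ ix l * pd (Inl l) (Bw L' m i k) w) +
      (\<Sum>l\<in>UNIV. (\<Sum>a\<in>UNIV. y_jet z l a * s_coord v a + y_jet v l a * s_coord z a) * PB L' m i k l w))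
       * z $ iX M k)) (at z)"
proof -
  note [derivative_intros] = bounded_linear.has_derivative[OF bounded_linear_vec_nth]
  have "((\<lambda>z. Bw L' m i k (jet_target z)) has_derivative (\<lambda>v.
      (\<Sum>l\<in>UNIV. v $ ix l * pd (Inl l) (Bw L' m i k) w) +
      (\<Sum>l\<in>UNIV. (\<Sum>a\<in>UNIV. y_jet z l a * s_coord v a + y_jet v l a * s_coord z a) * PB L' m i k l w))) (at z)" for k
    using has_derivative_compose[OF jet_target_has_derivative
        has_derivative_smooth[OF tgt.open_dom tgt.smooth_on_Bw target_in]]
    by (simp add: sum_UNIV_Plus PB_def)
  note [derivative_intros] = this
  show ?thesis
    unfolding jetN_def
    by (auto intro!: derivative_eq_intros)
qed

lemma frame_coeff_differentiable: "frame_coeff \<Gamma> L' K M m differentiable (at z)"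
  using differentiableI[OF jetM_has_derivative] differentiableI[OF jetN_has_derivative]
  by (simp add: frame_coeff_def split: sum.split)

section \<open>Vertical torsion components with unsplit capital indices\<close>

lemmas torsion_component =
  d_torsion_eq[OF jet_berwald_connection z_in frame_coeff_differentiable]
lemmas vf_jetM = vf_apply_has_derivative[OF jetM_has_derivative]
lemmas vf_jetN = vf_apply_has_derivative[OF jetN_has_derivative]

text \<open>The bracketed array is the curvature of the connection whose coefficients are \<Gamma>
  with its lower indices exchanged, because \<open>jetM\<close> has M in the direction slot. The
  quadratic terms arise when the vertical part of one frame field differentiates the jet variable in
  the coefficient of the other.\<close>

lemma torsion_vertical_TT:
  "\<tau> (iX M m) (iT A) (iT B) z = (\<Sum>C\<in>UNIV. (pd A (\<Gamma> C B M) T - pd B (\<Gamma> C A M) T +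
     (\<Sum>E\<in>UNIV. \<Gamma> E B M T * \<Gamma> C A E T - \<Gamma> E A M T * \<Gamma> C B E T)) * z $ iX C m)"
proof -
  have *: "vf_apply (adapted_basis \<Gamma> L' (iT B)) (jetM \<Gamma> m M A) z =
     - (\<Sum>C\<in>UNIV. (\<Sum>E\<in>UNIV. \<Gamma> E A M T * \<Gamma> C B E T) * z $ iX C m + pd B (\<Gamma> C A M) T * z $ iX C m)" for A B
  proof -
    have "(\<Sum>C\<in>UNIV. \<Gamma> C A M T * (\<Sum>E\<in>UNIV. \<Gamma> E B C T * z $ iX E m)) =
        (\<Sum>C\<in>UNIV. (\<Sum>E\<in>UNIV. \<Gamma> E A M T * \<Gamma> C B E T) * z $ iX C m)"
      unfolding sum_distrib_left sum_distrib_right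
      by (subst sum.swap) (simp add: mult_ac)
    then show ?thesis
      unfolding vf_jetM sum.distrib
      by (simp add: adapted_basis_nth jetM_def mult_delta_left cong: if_cong del: adapted_basis_simps)
  qed
  show ?thesis
    by (simp add: torsion_component * del: adapted_basis_simps)
       (simp add: sum.distrib sum_subtractf algebra_simps)
qed

text \<open>\<open>jetM\<close> acts on the lower and \<open>jetN\<close> on the upper index of the
  jet variable, so these actions commute and the products of \<Gamma> with \<open>Bw\<close> cancel.
  Only the change of the target fibre point inside \<open>Bw\<close> survives.\<close>

lemma torsion_vertical_Tx:
  "\<tau> (iX M m) (iT A) (ix j) z = - (\<Sum>k\<in>UNIV. (\<Sum>l\<in>UNIV.
     (\<Sum>a\<in>UNIV. (if A = Inr a then y_jet z l a else 0)
        + (\<Sum>E\<in>UNIV. \<Gamma> E A (Inr a) T * z $ iX E l) * s_coord z a) * PB L' m j k l w) * z $ iX M k)"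
proof -
  have "(\<Sum>C\<in>UNIV. \<Gamma> C A M T * (\<Sum>k\<in>UNIV. Bw L' m j k w * z $ iX C k)) =
      (\<Sum>k\<in>UNIV. Bw L' m j k w * (\<Sum>C\<in>UNIV. \<Gamma> C A M T * z $ iX C k))"
    unfolding sum_distrib_left by (subst sum.swap) (simp add: mult_ac)
  moreover have "vf_apply (adapted_basis \<Gamma> L' (ix j)) (jetM \<Gamma> m M A) z =
      (\<Sum>C\<in>UNIV. \<Gamma> C A M T * (\<Sum>k\<in>UNIV. Bw L' m j k w * z $ iX C k))"
    unfolding vf_jetM
    by (simp add: adapted_basis_nth jetN_def sum_negf del: adapted_basis_simps)
  moreover have "vf_apply (adapted_basis \<Gamma> L' (iT A)) (jetN L' m M j) z =
      (\<Sum>k\<in>UNIV. Bw L' m j k w * (\<Sum>C\<in>UNIV. \<Gamma> C A M T * z $ iX C k)) +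
      (\<Sum>k\<in>UNIV. (\<Sum>l\<in>UNIV. (\<Sum>a\<in>UNIV. (if A = Inr a then y_jet z l a else 0)
        + (\<Sum>E\<in>UNIV. \<Gamma> E A (Inr a) T * z $ iX E l) * s_coord z a) * PB L' m j k l w) * z $ iX M k)"
    unfolding vf_jetN
    by (simp add: adapted_basis_nth jetM_def mult_delta_right sum.distrib cong: if_cong del: adapted_basis_simps)
  ultimately show ?thesis
    by (simp add: torsion_component del: adapted_basis_simps)
qed

lemma torsion_vertical_xx:
  "\<tau> (iX M m) (ix i) (ix j) z = (\<Sum>k\<in>UNIV. (pd (Inl j) (Bw L' m i k) w - pd (Inl i) (Bw L' m j k) w
     + (\<Sum>r\<in>UNIV. Bw L' m j r w * Bw L' r i k w - Bw L' m i r w * Bw L' r j k w)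
     - (\<Sum>l\<in>UNIV. (\<Sum>a\<in>UNIV. (\<Sum>r\<in>UNIV. Bw L' l j r w * y_jet z r a) * s_coord z a) * PB L' m i k l w)
     + (\<Sum>l\<in>UNIV. (\<Sum>a\<in>UNIV. (\<Sum>r\<in>UNIV. Bw L' l i r w * y_jet z r a) * s_coord z a) * PB L' m j k l w))
     * z $ iX M k)"
proof -
  have *: "vf_apply (adapted_basis \<Gamma> L' (ix j)) (jetN L' m M i) z =
     (\<Sum>k\<in>UNIV. pd (Inl j) (Bw L' m i k) w * z $ iX M k
        - (\<Sum>r\<in>UNIV. Bw L' m i r w * Bw L' r j k w) * z $ iX M k
        - (\<Sum>l\<in>UNIV. (\<Sum>a\<in>UNIV. (\<Sum>r\<in>UNIV. Bw L' l j r w * y_jet z r a) * s_coord z a) * PB L' m i k l w)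
           * z $ iX M k)" for i j
  proof -
    have "(\<Sum>k\<in>UNIV. Bw L' m i k w * (\<Sum>r\<in>UNIV. Bw L' k j r w * z $ iX M r)) =
        (\<Sum>k\<in>UNIV. (\<Sum>r\<in>UNIV. Bw L' m i r w * Bw L' r j k w) * z $ iX M k)"
      unfolding sum_distrib_left sum_distrib_right
      by (subst sum.swap) (simp add: mult_ac)
    then show ?thesis
      unfolding vf_jetN
      by (simp add: adapted_basis_nth jetN_def mult_delta_left sum.distrib sum_subtractf sum_negf
          distrib_right left_diff_distrib cong: if_cong del: adapted_basis_simps)
  qed
  show ?thesis
    by (simp add: torsion_component * del: adapted_basis_simps)
       (simp add: sum.distrib sum_subtractf algebra_simps)
qed

text \<open>The derivative of the explicit jet variable in \<open>jetN\<close> cancels the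
  coefficient of \<open>D\<close>, up to exchanging lower indices of \<open>Bw\<close>. What remains
  is the dependence through the target fibre point, which involves only the Latin jet
  variables.\<close>

lemma torsion_vertical_xX:
  "\<tau> (iX M m) (ix i) (iX B j) z = (\<Sum>k\<in>UNIV. PB L' m i k j w * z $ iX M k *
     (case B of Inl \<beta> \<Rightarrow> 0 | Inr b \<Rightarrow> s_coord z b))"
proof -
  have "vf_apply (adapted_basis \<Gamma> L' (iX B j)) (jetN L' m M i) z =
     (if M = B then Bw L' m i j w else 0) +
     (\<Sum>k\<in>UNIV. PB L' m i k j w * z $ iX M k * (case B of Inl \<beta> \<Rightarrow> 0 | Inr b \<Rightarrow> s_coord z b))"
  proof (cases B)
    case (Inl \<beta>)
    then show ?thesis
      unfolding vf_jetN
      by (simp add: adapted_basis_nth mult_delta_right if_bool_eq_conj cong: if_cong del: adapted_basis_simps)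
  next
    case (Inr b)
    have "(\<Sum>l\<in>UNIV. (\<Sum>a\<in>UNIV. (if b = a \<and> j = l then 1 else 0) * s_coord z a) * PB L' m i k l w) =
        s_coord z b * PB L' m i k j w" for k
    proof -
      have "(\<Sum>a\<in>UNIV. (if b = a \<and> j = l then 1 else 0) * s_coord z a) = (if j = l then s_coord z b else 0)" for l
        by (cases "j = l") (simp_all add: mult_delta_left cong: if_cong)
      then show ?thesis by (simp add: mult_delta_left cong: if_cong)
    qed
    moreover have "(\<Sum>k\<in>UNIV. Bw L' m i k w * (if B = M \<and> j = k then 1 else 0)) = (if M = B then Bw L' m i j w else 0)"
      by (cases "M = B") (auto simp: mult_delta_right cong: if_cong)
    ultimately show ?thesis
      using Inr unfolding vf_jetN
      by (simp add: adapted_basis_nth sum.distrib mult_ac cong: if_cong del: adapted_basis_simps)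
  qed
  then show ?thesis
    by (simp add: torsion_component tgt.Bw_sym[OF target_in, of m i j] vf_apply_const del: adapted_basis_simps)
qed

text \<open>\<open>jetM\<close> is linear in the jet variables, and its derivative in them is
  exactly the coefficient with which \<open>D\<close> differentiates vertical fields.\<close>

lemma torsion_vertical_TX: "\<tau> (iX M m) (iT A) (iX B j) z = 0"
proof -
  have "(\<Sum>C\<in>UNIV. \<Gamma> C A M T * (if B = C \<and> j = m then 1 else 0)) = (if m = j then \<Gamma> B A M T else 0)"
    by (cases "m = j") (auto simp: mult_delta_right cong: if_cong)
  then show ?thesis
    by (simp add: torsion_component vf_jetM vf_apply_const adapted_basis_nth mult_delta_left
        del: adapted_basis_simps)
qed

section \<open>Vanishing components\<close>

lemmas conn = src.conn_coeff_nonzero[OF source_in] src.conn_coeff_zero[OF source_in]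
  src.pd_conn_coeff[OF source_in]

lemma torsion_antisym: "\<tau> U K H z = - \<tau> U H K z"
  by (simp add: torsion_component split: sum.split)

lemma torsion_horizontal_TT:
  "\<tau> (iT M) (iT A) (iT B) z = \<Gamma> M A B T - \<Gamma> M B A T"
  by (simp add: torsion_component)

lemma torsion_horizontal_zero:
  "\<tau> (iT M) (iT A) (Inr q) z = 0" "\<tau> (iT M) (Inr q) (Inr q') z = 0"
  "\<tau> (ix m) (iT A) H z = 0" "\<tau> (ix m) (ix i) (ix j) z = 0" "\<tau> (ix m) (Inr (Inr v)) H z = 0"
proof -
  show "\<tau> (iT M) (iT A) (Inr q) z = 0" "\<tau> (iT M) (Inr q) (Inr q') z = 0"
    by (cases q rule: sum.exhaust; cases q' rule: sum.exhaust; simp add: torsion_component)+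
  show "\<tau> (ix m) (ix i) (ix j) z = 0"
    by (simp add: torsion_component tgt.Bw_sym[OF target_in, of m i j])
  show "\<tau> (ix m) (iT A) H z = 0"
    by (cases H rule: sum.exhaust) (auto simp: torsion_component elim: sum.exhaust)
  show "\<tau> (ix m) (Inr (Inr v)) H z = 0"
    by (cases H rule: sum.exhaust) (auto simp: torsion_component elim: sum.exhaust)
qed

text \<open>Each quadratic term has a zero factor: a Greek intermediate index kills the first
  coefficient, a Latin one the second. The derivative terms are a difference of two equal fibre
  derivatives of \<open>Bw\<close>.\<close>

lemma torsion_vertical_TT_Latin: "\<tau> (iX M m) (iT (Inr a)) (iT (Inr b)) z = 0"
  by (cases M)
     (simp_all add: torsion_vertical_TT sum_UNIV_Plus conn sum.neutral
        src.PB_sym_13[OF source_in, of _ b _ a, unfolded PB_def])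

lemma torsion_vertical_XX: "\<tau> (iX M m) (Inr (Inr u)) (Inr (Inr v)) z = 0"
  by (cases u; cases v) (simp add: torsion_component vf_apply_const)

text \<open>The predicate lists mixed pairs of lower indices in one order only, so both orders are
  excluded; reversed pairs are reduced by antisymmetry.\<close>

lemma torsion_vanishing:
  assumes "\<not> nonvanishing_family U K H" "\<not> nonvanishing_family U H K"
  shows "\<tau> U K H z = 0"
proof -
  have vertical: "\<tau> (iX M m) K H z = 0"
    if "\<not> nonvanishing_family (iX M m) K H" "\<not> nonvanishing_family (iX M m) H K" for M m
  proof -
    consider (TT) A B where "K = iT A" "H = iT B" | (Tx) A j where "K = iT A" "H = ix j"
      | (TX) A B j where "K = iT A" "H = iX B j" | (xT) i B where "K = ix i" "H = iT B"
      | (xx) i j where "K = ix i" "H = ix j" | (xX) i B j where "K = ix i" "H = iX B j"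
      | (XT) A i B where "K = iX A i" "H = iT B" | (Xx) A i j where "K = iX A i" "H = ix j"
      | (XX) A i B j where "K = iX A i" "H = iX B j"
      by (metis sumE surj_pair)
    then show ?thesis
    proof cases
      case TT
      then show ?thesis using that
        by (cases M; cases A; cases B) (auto simp: torsion_vertical_TT_Latin intro: nonvanishing_family.intros)
    next
      case Tx
      then show ?thesis using that by (cases M; cases A) (auto intro: nonvanishing_family.intros)
    next
      case xT
      then show ?thesis using that by (cases M; cases B) (auto intro: nonvanishing_family.intros)
    next
      case xx
      then show ?thesis using that by (cases M) (auto intro: nonvanishing_family.intros)
    next
      case xX
      then show ?thesis using that
        by (cases M; cases B) (auto simp: torsion_vertical_xX intro: nonvanishing_family.intros)
    next
      case Xx
      then show ?thesis using that torsion_antisym[of _ K H]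
        by (cases M; cases A) (auto simp: torsion_vertical_xX intro: nonvanishing_family.intros)
    next
      case XT
      then show ?thesis using torsion_antisym[of _ K H] by (simp add: torsion_vertical_TX)
    qed (simp_all add: torsion_vertical_TX torsion_vertical_XX)
  qed
  consider (T) M where "U = iT M" | (x) m where "U = ix m" | (X) M m where "U = iX M m"
    by (metis sumE surj_pair)
  then show ?thesis
  proof cases
    case (T M)
    show ?thesis
    proof (cases "\<exists>A B. K = iT A \<and> H = iT B")
      case True
      then obtain A B where AB: "K = iT A" "H = iT B" by blast
      show ?thesis
      proof (cases "\<exists>\<alpha> \<beta>. A = Inl \<alpha> \<and> B = Inl \<beta>")
        case True
        then show ?thesis
          using assms(1) T AB
          by (cases M) (auto simp: torsion_horizontal_TT conn src.Bw_sym[OF source_in] intro: nonvanishing_family.intros)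
      next
        \<comment> \<open>With a Latin lower index the two coefficients are either both zero or
          \<open>Bw\<close> with its lower indices exchanged.\<close>
        case False
        then show ?thesis
          by (cases M; cases A; cases B) (auto simp: T AB torsion_horizontal_TT conn src.Bw_sym[OF source_in])
      qed
    next
      case False
      then show ?thesis
        using torsion_antisym[of U K H] by (cases K; cases H) (auto simp: T torsion_horizontal_zero)
    qed
  next
    case (x m)
    consider (l) A where "K = iT A \<or> H = iT A" | (X) v where "K = Inr (Inr v) \<or> H = Inr (Inr v)"
      | (xx) i j where "K = ix i" "H = ix j"
      by (metis sumE)
    then show ?thesis
      using torsion_antisym[of U K H] by cases (auto simp: x torsion_horizontal_zero)
  next
    case X
    then show ?thesis using vertical assms by simp
  qed
qed

section \<open>The nonvanishing families\<close>

lemma torsion_T1: "\<tau> (iT (Inr a)) (iT (Inl \<beta>)) (iT (Inl \<gamma>)) z = Ncol L a \<beta> \<gamma> T - Ncol L a \<gamma> \<beta> T"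
  by (simp add: torsion_horizontal_TT conn)

lemma torsion_T2_T3: "\<tau> (iX M m) (ix i) (iX (Inr b) j) z = (\<Sum>k\<in>UNIV. PB L' m i k j w * z $ iX M k * s_coord z b)"
  by (simp add: torsion_vertical_xX)

text \<open>\<open>RB\<close> is built from \<open>delta_t\<close>, while the jet computation yields
  plain partial derivatives. The products of \<open>PB\<close> and \<open>Nl\<close> cancel the
  fibre parts of \<open>delta_t\<close>; the sign reflects the order of \<alpha> and
  \<beta>.\<close>

lemma curvature_Berwald:
  "pd (Inl \<alpha>) (Bw L \<epsilon> \<beta> \<mu>) T - pd (Inl \<beta>) (Bw L \<epsilon> \<alpha> \<mu>) T
     + (\<Sum>\<gamma>\<in>UNIV. Bw L \<gamma> \<beta> \<mu> T * Bw L \<epsilon> \<alpha> \<gamma> T - Bw L \<gamma> \<alpha> \<mu> T * Bw L \<epsilon> \<beta> \<gamma> T) =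
   - (RB L \<epsilon> \<mu> \<alpha> \<beta> T + (\<Sum>c\<in>UNIV. PB L \<epsilon> \<mu> \<alpha> c T * Nl L c \<beta> T)
        - (\<Sum>c\<in>UNIV. PB L \<epsilon> \<mu> \<beta> c T * Nl L c \<alpha> T))"
proof -
  note sym = src.Bw_sym[OF source_in] and psym = src.pd_Bw_sym[OF source_in]
  show ?thesis
    unfolding psym[of _ _ \<beta> \<mu>] psym[of _ _ \<alpha> \<mu>] sym[of _ \<beta> \<mu>] sym[of _ \<alpha> \<mu>] sym[of \<epsilon> \<alpha>] sym[of \<epsilon> \<beta>]
    by (simp add: RB_def PB_def delta_t_def sum_subtractf mult.commute)
qed

lemma torsion_T4:
  "\<tau> (iX (Inl \<mu>) m) (iT (Inl \<alpha>)) (iT (Inl \<beta>)) z =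
        - (\<Sum>\<epsilon>\<in>UNIV. (RB L \<epsilon> \<mu> \<alpha> \<beta> T + (\<Sum>c\<in>UNIV. PB L \<epsilon> \<mu> \<alpha> c T * Nl L c \<beta> T)
              - (\<Sum>c\<in>UNIV. PB L \<epsilon> \<mu> \<beta> c T * Nl L c \<alpha> T)) * x_jet z m \<epsilon>)
        + alt_sum (\<lambda>\<alpha> \<beta>. \<Sum>c\<in>UNIV. (pd (Inl \<alpha>) (Ncol L c \<beta> \<mu>) T
              + (\<Sum>d\<in>UNIV. Ncol L d \<beta> \<mu> T * Bw L c d \<alpha> T)
              - (\<Sum>\<gamma>\<in>UNIV. Ncol L c \<beta> \<gamma> T * Bw L \<gamma> \<alpha> \<mu> T)) * y_jet z m c) \<alpha> \<beta>"
proof -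
  \<comment> \<open>The contracted index C splits into a Greek part, which is a curvature, and a
    Latin part, whose two quadratic sums come from a Greek and a Latin intermediate index.\<close>
  have "\<tau> (iX (Inl \<mu>) m) (iT (Inl \<alpha>)) (iT (Inl \<beta>)) z =
    (\<Sum>\<epsilon>\<in>UNIV. (pd (Inl \<alpha>) (Bw L \<epsilon> \<beta> \<mu>) T - pd (Inl \<beta>) (Bw L \<epsilon> \<alpha> \<mu>) T
     + (\<Sum>\<gamma>\<in>UNIV. Bw L \<gamma> \<beta> \<mu> T * Bw L \<epsilon> \<alpha> \<gamma> T - Bw L \<gamma> \<alpha> \<mu> T * Bw L \<epsilon> \<beta> \<gamma> T)) * x_jet z m \<epsilon>) +
    (\<Sum>c\<in>UNIV. (pd (Inl \<alpha>) (Ncol L c \<beta> \<mu>) T - pd (Inl \<beta>) (Ncol L c \<alpha> \<mu>) T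
     + (\<Sum>\<gamma>\<in>UNIV. Bw L \<gamma> \<beta> \<mu> T * Ncol L c \<alpha> \<gamma> T - Bw L \<gamma> \<alpha> \<mu> T * Ncol L c \<beta> \<gamma> T)
     + (\<Sum>d\<in>UNIV. Ncol L d \<beta> \<mu> T * Bw L c d \<alpha> T - Ncol L d \<alpha> \<mu> T * Bw L c d \<beta> T)) * y_jet z m c)"
    by (simp add: torsion_vertical_TT sum_UNIV_Plus conn
        src.Bw_sym[OF source_in, of _ \<alpha>] src.Bw_sym[OF source_in, of _ \<beta>] add_ac)
  also have "(\<Sum>c\<in>UNIV. (pd (Inl \<alpha>) (Ncol L c \<beta> \<mu>) T - pd (Inl \<beta>) (Ncol L c \<alpha> \<mu>) T
     + (\<Sum>\<gamma>\<in>UNIV. Bw L \<gamma> \<beta> \<mu> T * Ncol L c \<alpha> \<gamma> T - Bw L \<gamma> \<alpha> \<mu> T * Ncol L c \<beta> \<gamma> T)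
     + (\<Sum>d\<in>UNIV. Ncol L d \<beta> \<mu> T * Bw L c d \<alpha> T - Ncol L d \<alpha> \<mu> T * Bw L c d \<beta> T)) * y_jet z m c) =
    alt_sum (\<lambda>\<alpha> \<beta>. \<Sum>c\<in>UNIV. (pd (Inl \<alpha>) (Ncol L c \<beta> \<mu>) T
              + (\<Sum>d\<in>UNIV. Ncol L d \<beta> \<mu> T * Bw L c d \<alpha> T)
              - (\<Sum>\<gamma>\<in>UNIV. Ncol L c \<beta> \<gamma> T * Bw L \<gamma> \<alpha> \<mu> T)) * y_jet z m c) \<alpha> \<beta>"
    unfolding alt_sum_def sum_subtractf[symmetric]
    by (intro sum.cong refl) (simp add: sum_subtractf algebra_simps)
  finally show ?thesis unfolding curvature_Berwald by (simp only: mult_minus_left sum_negf)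
qed

lemma torsion_T5:
  "\<tau> (iX (Inl \<mu>) m) (iT (Inl \<alpha>)) (iT (Inr b)) z =
        - (\<Sum>\<epsilon>\<in>UNIV. PB L \<epsilon> \<mu> \<alpha> b T * x_jet z m \<epsilon>)
        + (\<Sum>c\<in>UNIV. (pd (Inl \<alpha>) (Bw L c b \<mu>) T - pd (Inr b) (Ncol L c \<alpha> \<mu>) T
              + (\<Sum>d\<in>UNIV. Bw L d b \<mu> T * Bw L c d \<alpha> T)
              - (\<Sum>\<gamma>\<in>UNIV. Bw L \<gamma> \<alpha> \<mu> T * Bw L c \<gamma> b T)) * y_jet z m c)"
  by (simp add: torsion_vertical_TT sum_UNIV_Plus conn PB_def sum_negf sum_subtractf add_diff_eq
        src.pd_Bw_sym[OF source_in, of _ _ \<alpha> \<mu>]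
        src.Bw_sym[OF source_in, of _ \<alpha>] src.Bw_sym[OF source_in, of _ b])

lemma torsion_T8:
  "\<tau> (iX (Inr c) m) (iT (Inl \<alpha>)) (iT (Inr b)) z = - (\<Sum>d\<in>UNIV. PB L d c \<alpha> b T * y_jet z m d)"
  by (simp add: torsion_vertical_TT sum_UNIV_Plus conn PB_def sum_negf
        src.pd_Bw_sym[OF source_in, of _ _ \<alpha> c])

lemma torsion_T7:
  "\<tau> (iX (Inr c) m) (iT (Inl \<alpha>)) (iT (Inl \<beta>)) z =
        - (\<Sum>d\<in>UNIV. (RB L d c \<alpha> \<beta> T + (\<Sum>f\<in>UNIV. PB L d c \<alpha> f T * Nl L f \<beta> T)
              - (\<Sum>f\<in>UNIV. PB L d c \<beta> f T * Nl L f \<alpha> T)) * y_jet z m d)"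
  \<comment> \<open>For a Latin index c only Latin intermediate indices contribute, and they carry
    the same array \<open>Bw\<close>; the curvature identity therefore applies, read from right to
    left.\<close>
  unfolding sum_negf[symmetric] mult_minus_left[symmetric] curvature_Berwald[symmetric]
  by (simp add: torsion_vertical_TT sum_UNIV_Plus conn)

text \<open>For Greek A the target fibre point moves only through the vertical components of the
  frame field, hence the factor \<open>Bw\<close>. For Latin A these contributions vanish and s
  itself moves, which gives the shorter formula that follows.\<close>

lemma torsion_T10_T12:
  "\<tau> (iX M m) (iT (Inl \<alpha>)) (ix j) z = - (\<Sum>k\<in>UNIV. \<Sum>l\<in>UNIV. \<Sum>b\<in>UNIV. \<Sum>c\<in>UNIV.
     PB L' m j k l w * Bw L c \<alpha> b T * s_coord z b * z $ iX M k * y_jet z l c)"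
  by (simp add: torsion_vertical_Tx sum_UNIV_Plus conn sum_distrib_left sum_distrib_right mult_ac)

lemma torsion_T11_T13:
  "\<tau> (iX M m) (iT (Inr a)) (ix j) z =
     - (\<Sum>k\<in>UNIV. \<Sum>l\<in>UNIV. PB L' m j k l w * z $ iX M k * y_jet z l a)"
  by (simp add: torsion_vertical_Tx sum_UNIV_Plus conn sum_distrib_left sum_distrib_right mult_ac)

text \<open>Exchanging the two lower indices reduces this to \<open>torsion_T5\<close>; symmetry of
  \<open>PB\<close> restores their order.\<close>

lemma torsion_T6:
  "\<tau> (iX (Inl \<mu>) m) (iT (Inr a)) (iT (Inl \<beta>)) z =
        (\<Sum>\<epsilon>\<in>UNIV. PB L \<epsilon> \<mu> a \<beta> T * x_jet z m \<epsilon>)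
        - (\<Sum>c\<in>UNIV. (pd (Inl \<beta>) (Bw L c a \<mu>) T - pd (Inr a) (Ncol L c \<beta> \<mu>) T
              + (\<Sum>d\<in>UNIV. Bw L d a \<mu> T * Bw L c d \<beta> T)
              - (\<Sum>\<gamma>\<in>UNIV. Bw L \<gamma> \<beta> \<mu> T * Bw L c \<gamma> a T)) * y_jet z m c)"
  unfolding torsion_antisym[of _ "iT (Inr a)"] torsion_T5
  by (simp add: src.PB_sym_23[OF source_in, of _ \<mu> \<beta> a])

lemma torsion_T9:
  "\<tau> (iX (Inr c) m) (iT (Inr a)) (iT (Inl \<beta>)) z = (\<Sum>d\<in>UNIV. PB L d c a \<beta> T * y_jet z m d)"
  unfolding torsion_antisym[of _ "iT (Inr a)"] torsion_T8
  by (simp add: src.PB_sym_23[OF source_in, of _ c \<beta> a])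

text \<open>Along an adapted x field the target fibre point moves by minus \<open>Bw\<close>
  contracted with y s, which gives the second sum. The \<open>Nl\<close> terms of the first sum turn
  plain partial derivatives into those in \<open>RB\<close>.\<close>

lemma torsion_T14_T15:
  "\<tau> (iX M m) (ix i) (ix j) z =
        (\<Sum>k\<in>UNIV. (RB L' m k i j w + (\<Sum>l\<in>UNIV. PB L' m k i l w * Nl L' l j w)
              - (\<Sum>l\<in>UNIV. PB L' m k j l w * Nl L' l i w)) * z $ iX M k)
        - (\<Sum>k\<in>UNIV. \<Sum>r\<in>UNIV. \<Sum>a\<in>UNIV.
             ((\<Sum>l\<in>UNIV. PB L' m k i l w * Bw L' l j r w) - (\<Sum>l\<in>UNIV. PB L' m k j l w * Bw L' l i r w))
             * z $ iX M k * y_jet z r a * s_coord z a)"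
proof -
  have fibre: "(\<Sum>l\<in>UNIV. (\<Sum>a\<in>UNIV. (\<Sum>r\<in>UNIV. Bw L' l j r w * y_jet z r a) * s_coord z a) * PB L' m i k l w) =
    (\<Sum>r\<in>UNIV. \<Sum>a\<in>UNIV. (\<Sum>l\<in>UNIV. PB L' m k i l w * Bw L' l j r w) * y_jet z r a * s_coord z a)" for i j k
  proof -
    have "(\<Sum>l\<in>UNIV. (\<Sum>a\<in>UNIV. (\<Sum>r\<in>UNIV. Bw L' l j r w * y_jet z r a) * s_coord z a) * PB L' m i k l w) =
      (\<Sum>l\<in>UNIV. \<Sum>r\<in>UNIV. \<Sum>a\<in>UNIV. PB L' m k i l w * Bw L' l j r w * y_jet z r a * s_coord z a)"
      unfolding sum_distrib_right
      by (subst sum.swap[of _ UNIV "UNIV :: 'n set"])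
         (simp add: tgt.PB_sym_12[OF target_in, of _ i k] mult_ac)
    also have "\<dots> = (\<Sum>r\<in>UNIV. \<Sum>a\<in>UNIV. \<Sum>l\<in>UNIV. PB L' m k i l w * Bw L' l j r w * y_jet z r a * s_coord z a)"
      by (subst sum.swap) (intro sum.cong refl sum.swap)
    finally show ?thesis by (simp add: sum_distrib_right)
  qed
  note sym = tgt.Bw_sym[OF target_in] and psym = tgt.pd_Bw_sym[OF target_in]
  \<comment> \<open>Counterpart on the target of \<open>curvature_Berwald\<close>, with the opposite
    overall sign, as \<open>jetN\<close> is plus and \<open>jetM\<close> minus the contraction of
    its coefficients with the jet variables.\<close>
  have curv: "pd (Inl j) (Bw L' m i k) w - pd (Inl i) (Bw L' m j k) w
      + (\<Sum>r\<in>UNIV. Bw L' m j r w * Bw L' r i k w - Bw L' m i r w * Bw L' r j k w) =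
    RB L' m k i j w + (\<Sum>l\<in>UNIV. PB L' m k i l w * Nl L' l j w)
      - (\<Sum>l\<in>UNIV. PB L' m k j l w * Nl L' l i w)" for k
    unfolding psym[of _ _ i k] psym[of _ _ j k] sym[of _ i k] sym[of _ j k] sym[of m i] sym[of m j]
    by (simp add: RB_def PB_def delta_t_def sum_subtractf mult.commute)
  show ?thesis
    unfolding torsion_vertical_xx fibre curv
    by (simp add: sum.distrib sum_subtractf algebra_simps sum_distrib_left sum_distrib_right)
qed

end

section \<open>From Finsler manifolds to regular Lagrangians\<close>

lemma open_slit_domain: "open (chart_image c) \<Longrightarrow> open (slit_domain c)"
proof -
  assume "open (chart_image c)"
  moreover have "continuous_on UNIV base_part" "continuous_on UNIV fibre_part"
    unfolding base_part_def fibre_part_def by (intro continuous_intros)+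
  ultimately have "open (base_part -` chart_image c)" "open (fibre_part -` (- {0}))"
    by (auto intro!: open_vimage)
  moreover have "slit_domain c = base_part -` chart_image c \<inter> fibre_part -` (- {0})"
    by (auto simp: slit_domain_def)
  ultimately show ?thesis by auto
qed

text \<open>A nonzero kernel vector of the fundamental tensor would make its quadratic form vanish
  there, against positivity.\<close>

lemma finsler_regular_lagrangian:
  assumes F: "finsler_manifold \<A> F" and c: "c \<in> \<A>"
  shows "regular_lagrangian (slit_domain c) (local_rep \<A> c F)"
proof
  show "open (slit_domain c)"
    using F c by (auto simp: finsler_manifold_def smooth_atlas_def intro: open_slit_domain)
  show "smooth_on (slit_domain c) (local_rep \<A> c F)"
    using F c by (simp add: finsler_manifold_def)
  fix T assume T: "T \<in> slit_domain c"
  let ?A = "\<chi> \<alpha> \<beta>. fund (local_rep \<A> c F) \<alpha> \<beta> T"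
  have "u = 0" if "?A *v u = 0" for u
  proof (rule ccontr)
    assume "u \<noteq> 0"
    then have "(\<Sum>\<alpha>\<in>UNIV. \<Sum>\<beta>\<in>UNIV. fund (local_rep \<A> c F) \<alpha> \<beta> T * u $ \<alpha> * u $ \<beta>) > 0"
      using F c T unfolding finsler_manifold_def by blast
    moreover have "(\<Sum>\<alpha>\<in>UNIV. \<Sum>\<beta>\<in>UNIV. fund (local_rep \<A> c F) \<alpha> \<beta> T * u $ \<alpha> * u $ \<beta>) =
        (\<Sum>\<alpha>\<in>UNIV. u $ \<alpha> * (?A *v u) $ \<alpha>)"
      by (simp add: matrix_vector_mult_def sum_distrib_left mult_ac)
    ultimately show False by (simp only: that) simp
  qed
  then show "invertible ?A"
    by (simp add: invertible_left_inverse matrix_left_invertible_ker)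
qed

theorem theorem5p9:
  fixes \<A> :: "('m::{t2_space,second_countable_topology}, 'p::finite) chart set"
    and \<B> :: "('q::{t2_space,second_countable_topology}, 'n::finite) chart set"
    and F :: "'m \<times> (('m, 'p) chart \<Rightarrow> real^'p) \<Rightarrow> real"
    and F' :: "'q \<times> (('q, 'n) chart \<Rightarrow> real^'n) \<Rightarrow> real"
    and \<phi> :: "('m, 'p) chart" and \<psi> :: "('q, 'n) chart"
    and L :: "real^('p + 'p) \<Rightarrow> real" and L' :: "real^('n + 'n) \<Rightarrow> real"
    and nabla :: "('p + 'p) vfield \<Rightarrow> ('p + 'p) vfield \<Rightarrow> ('p + 'p) vfield"
    and D :: "('p, 'n) jidx vfield \<Rightarrow> ('p, 'n) jidx vfield \<Rightarrow> ('p, 'n) jidx vfield"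
    and \<tau> :: "('p, 'n) jidx \<Rightarrow> ('p, 'n) jidx \<Rightarrow> ('p, 'n) jidx \<Rightarrow> ('p, 'n) jet \<Rightarrow> real"
    and z :: "('p, 'n) jet" and T :: "real^('p + 'p)" and w :: "real^('n + 'n)"
  assumes "finsler_manifold \<A> F" and "finsler_manifold \<B> F'"
    and "\<phi> \<in> \<A>" and "\<psi> \<in> \<B>"
    and "L = local_rep \<A> \<phi> F" and "L' = local_rep \<B> \<psi> F'"
    and "berwald_connection (slit_domain \<phi>) L nabla"
    and "jet_berwald_connection (jet_domain \<phi> \<psi>) (conn_coeff nabla) L' D"
    and "\<tau> = d_torsion (conn_coeff nabla) L' D"
    and "z \<in> jet_domain \<phi> \<psi>" and "T = jet_source z" and "w = jet_target z"
  shows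
    "(\<forall>U K H. \<not> nonvanishing_family U K H \<and> \<not> nonvanishing_family U H K \<longrightarrow> \<tau> U K H z = 0) \<and>
     (\<forall>a \<beta> \<gamma>.
        \<tau> (iT (Inr a)) (iT (Inl \<beta>)) (iT (Inl \<gamma>)) z = Ncol L a \<beta> \<gamma> T - Ncol L a \<gamma> \<beta> T \<and>
        Ncol L a \<beta> \<gamma> T - Ncol L a \<gamma> \<beta> T = RN L a \<beta> \<gamma> T) \<and>
     (\<forall>m \<mu> i b j.
        \<tau> (iX (Inl \<mu>) m) (ix i) (iX (Inr b) j) z =
        (\<Sum>k\<in>UNIV. PB L' m i k j w * x_jet z k \<mu> * s_coord z b)) \<and>
     (\<forall>m c i b j.
        \<tau> (iX (Inr c) m) (ix i) (iX (Inr b) j) z =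
        (\<Sum>k\<in>UNIV. PB L' m i k j w * y_jet z k c * s_coord z b)) \<and>
     (\<forall>m \<mu> \<alpha> \<beta>.
        \<tau> (iX (Inl \<mu>) m) (iT (Inl \<alpha>)) (iT (Inl \<beta>)) z =
        - (\<Sum>\<epsilon>\<in>UNIV. (RB L \<epsilon> \<mu> \<alpha> \<beta> T + (\<Sum>c\<in>UNIV. PB L \<epsilon> \<mu> \<alpha> c T * Nl L c \<beta> T)
              - (\<Sum>c\<in>UNIV. PB L \<epsilon> \<mu> \<beta> c T * Nl L c \<alpha> T)) * x_jet z m \<epsilon>)
        + alt_sum (\<lambda>\<alpha> \<beta>. \<Sum>c\<in>UNIV. (pd (Inl \<alpha>) (Ncol L c \<beta> \<mu>) T
              + (\<Sum>d\<in>UNIV. Ncol L d \<beta> \<mu> T * Bw L c d \<alpha> T)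
              - (\<Sum>\<gamma>\<in>UNIV. Ncol L c \<beta> \<gamma> T * Bw L \<gamma> \<alpha> \<mu> T)) * y_jet z m c) \<alpha> \<beta>) \<and>
     (\<forall>m \<mu> \<alpha> b.
        \<tau> (iX (Inl \<mu>) m) (iT (Inl \<alpha>)) (iT (Inr b)) z =
        - (\<Sum>\<epsilon>\<in>UNIV. PB L \<epsilon> \<mu> \<alpha> b T * x_jet z m \<epsilon>)
        + (\<Sum>c\<in>UNIV. (pd (Inl \<alpha>) (Bw L c b \<mu>) T - pd (Inr b) (Ncol L c \<alpha> \<mu>) T
              + (\<Sum>d\<in>UNIV. Bw L d b \<mu> T * Bw L c d \<alpha> T)
              - (\<Sum>\<gamma>\<in>UNIV. Bw L \<gamma> \<alpha> \<mu> T * Bw L c \<gamma> b T)) * y_jet z m c)) \<and>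
     (\<forall>m \<mu> a \<beta>.
        \<tau> (iX (Inl \<mu>) m) (iT (Inr a)) (iT (Inl \<beta>)) z =
        (\<Sum>\<epsilon>\<in>UNIV. PB L \<epsilon> \<mu> a \<beta> T * x_jet z m \<epsilon>)
        - (\<Sum>c\<in>UNIV. (pd (Inl \<beta>) (Bw L c a \<mu>) T - pd (Inr a) (Ncol L c \<beta> \<mu>) T
              + (\<Sum>d\<in>UNIV. Bw L d a \<mu> T * Bw L c d \<beta> T)
              - (\<Sum>\<gamma>\<in>UNIV. Bw L \<gamma> \<beta> \<mu> T * Bw L c \<gamma> a T)) * y_jet z m c)) \<and>
     (\<forall>m c \<alpha> \<beta>.
        \<tau> (iX (Inr c) m) (iT (Inl \<alpha>)) (iT (Inl \<beta>)) z =
        - (\<Sum>d\<in>UNIV. (RB L d c \<alpha> \<beta> T + (\<Sum>f\<in>UNIV. PB L d c \<alpha> f T * Nl L f \<beta> T)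
              - (\<Sum>f\<in>UNIV. PB L d c \<beta> f T * Nl L f \<alpha> T)) * y_jet z m d)) \<and>
     (\<forall>m c \<alpha> b.
        \<tau> (iX (Inr c) m) (iT (Inl \<alpha>)) (iT (Inr b)) z =
        - (\<Sum>d\<in>UNIV. PB L d c \<alpha> b T * y_jet z m d)) \<and>
     (\<forall>m c a \<beta>.
        \<tau> (iX (Inr c) m) (iT (Inr a)) (iT (Inl \<beta>)) z =
        (\<Sum>d\<in>UNIV. PB L d c a \<beta> T * y_jet z m d)) \<and>
     (\<forall>m \<mu> \<alpha> j.
        \<tau> (iX (Inl \<mu>) m) (iT (Inl \<alpha>)) (ix j) z =
        - (\<Sum>k\<in>UNIV. \<Sum>l\<in>UNIV. \<Sum>b\<in>UNIV. \<Sum>c\<in>UNIV.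
             PB L' m j k l w * Bw L c \<alpha> b T * s_coord z b * x_jet z k \<mu> * y_jet z l c)) \<and>
     (\<forall>m \<mu> a j.
        \<tau> (iX (Inl \<mu>) m) (iT (Inr a)) (ix j) z =
        - (\<Sum>k\<in>UNIV. \<Sum>l\<in>UNIV. PB L' m j k l w * x_jet z k \<mu> * y_jet z l a)) \<and>
     (\<forall>m c \<alpha> j.
        \<tau> (iX (Inr c) m) (iT (Inl \<alpha>)) (ix j) z =
        - (\<Sum>k\<in>UNIV. \<Sum>l\<in>UNIV. \<Sum>b\<in>UNIV. \<Sum>d\<in>UNIV.
             PB L' m j k l w * Bw L d \<alpha> b T * s_coord z b * y_jet z k c * y_jet z l d)) \<and>
     (\<forall>m c a j.
        \<tau> (iX (Inr c) m) (iT (Inr a)) (ix j) z =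
        - (\<Sum>k\<in>UNIV. \<Sum>l\<in>UNIV. PB L' m j k l w * y_jet z k c * y_jet z l a)) \<and>
     (\<forall>m \<mu> i j.
        \<tau> (iX (Inl \<mu>) m) (ix i) (ix j) z =
        (\<Sum>k\<in>UNIV. (RB L' m k i j w + (\<Sum>l\<in>UNIV. PB L' m k i l w * Nl L' l j w)
              - (\<Sum>l\<in>UNIV. PB L' m k j l w * Nl L' l i w)) * x_jet z k \<mu>)
        - (\<Sum>k\<in>UNIV. \<Sum>r\<in>UNIV. \<Sum>a\<in>UNIV.
             ((\<Sum>l\<in>UNIV. PB L' m k i l w * Bw L' l j r w) - (\<Sum>l\<in>UNIV. PB L' m k j l w * Bw L' l i r w))
             * x_jet z k \<mu> * y_jet z r a * s_coord z a)) \<and>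
     (\<forall>m c i j.
        \<tau> (iX (Inr c) m) (ix i) (ix j) z =
        (\<Sum>k\<in>UNIV. (RB L' m k i j w + (\<Sum>l\<in>UNIV. PB L' m k i l w * Nl L' l j w)
              - (\<Sum>l\<in>UNIV. PB L' m k j l w * Nl L' l i w)) * y_jet z k c)
        - (\<Sum>k\<in>UNIV. \<Sum>r\<in>UNIV. \<Sum>a\<in>UNIV.
             ((\<Sum>l\<in>UNIV. PB L' m k i l w * Bw L' l j r w) - (\<Sum>l\<in>UNIV. PB L' m k j l w * Bw L' l i r w))
             * y_jet z k c * y_jet z r a * s_coord z a))"
proof -
  interpret src: regular_lagrangian "slit_domain \<phi>" L
    unfolding assms(5) using assms(1,3) by (rule finsler_regular_lagrangian)
  interpret tgt: regular_lagrangian "slit_domain \<psi>" L'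
    unfolding assms(6) using assms(2,4) by (rule finsler_regular_lagrangian)
  \<comment> \<open>The jet domain consists of the points whose source and target images both lie in
    the slit domains, so all symmetries and smoothness facts are available there.\<close>
  interpret jet_berwald "slit_domain \<phi>" L nabla "slit_domain \<psi>" L' "jet_domain \<phi> \<psi>" D z
    using assms(7,8,10) by unfold_locales (auto simp: jet_domain_def)
  show ?thesis
    unfolding assms(9,11,12)
    by (intro conjI allI impI torsion_vanishing torsion_T1 src.Ncol_antisym source_in torsion_T2_T3
        torsion_T4 torsion_T5 torsion_T6 torsion_T7 torsion_T8 torsion_T9 torsion_T10_T12
        torsion_T11_T13 torsion_T14_T15) simp_all
qed

end
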